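(* Let $m=2^{M+1}$ and let $b\ge\max\{b_0,b_1\}$ be fixed, with $M$, $b_0$, $b_1$ as described in the context. Let \[ D_n:=\sum_{\substack{-\lfloor b\sqrt n\rfloor\le j_1,\dots,j_{m-1}\le\lfloor b\sqrt n\rfloor\\ j_1+\cdots+j_m=0}}\left|\frac{1}{m^n}\binom{n}{\frac nm+j_1,\dots,\frac nm+j_m}-\frac{m^{m/2}}{(2\pi n)^{\frac{m-1}{2}}}\,e^{-\frac m2\sum_{i=1}^m\frac{j_i^2}{n}}\right|, \] where the sum is over integers $j_1,\dots,j_{m-1}$ in the indicated range and $j_m=-(j_1+\cdots+j_{m-1})$. Then \[ D_n\le\frac{2m^2}{3\sqrt{2\pi n}}+O(n^{-1}). \]
   Context: Here $n$ is a positive integer, $O(n^{-1})$ refers to $n\to\infty$, and $\binom{n}{k_1,\dots,k_m}$ with $k_1+\cdots+k_m=n$ denotes the multinomial coefficient $\frac{n!}{k_1!\cdots k_m!}$ (taken to be $0$ if some $k_i$ is a negative integer). $\|f\|_\infty=\sup|f|$. Setting. $\epsilon>0$ is fixed, $f:\mathbb{R}\to\mathbb{R}$ is a fixed bounded continuous function, and $Z$ is a real random variable with $E(Z)=0$, $\mathrm{var}(Z)=1$. $X(x):=\inf\{y\in\mathbb{R}: P(Z\le y)\ge x\}$ is its quantile function, a random variable on $[0,1]$ with Lebesgue measure. For $x\in(0,1)$, $\epsilon_i(x)$ is the $i$th binary digit of $x$ (dyadic rationals using the expansion ending in $0$'s). $H_{j,k}$ ($j\ge0$, $0\le k\le 2^j-1$)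 are the Haar functions, equal to $2^{j/2}$ on $[\frac{k}{2^j},\frac{k+1/2}{2^j})$, $-2^{j/2}$ on $[\frac{k+1/2}{2^j},\frac{k+1}{2^j})$, and $0$ otherwise; $c_{j,k}=\int_0^1X(x)H_{j,k}(x)\,dx$. $M\ge1$ is an integer such that $\sigma_M:=\sqrt{\sum_{j=0}^M\sum_{k=0}^{2^j-1}c_{j,k}^2}>0$. The function \[ X_M(x):=\frac1{\sigma_M}\sum_{j=0}^M2^{j/2}c_{j,\lfloor2^jx\rfloor}(-1)^{\epsilon_{j+1}(x)} \] is constant on each dyadic interval of length $1/m$, $m=2^{M+1}$; $o_1,\dots,o_m$ denote its $m$ values on these intervals (with multiplicity). Constants. With $q(n,k_1,\dots,k_m):=\left(\frac1m\right)^n\binom{n}{k_1,\dots,k_m}f\left(\frac{\sum_{i=1}^mk_io_i}{\sqrt n}\right)$, the number $b_0$ is such that for all $b\ge b_0$ and all $n\ge1$ the absolute value of the difference between the sum of $q(n,k_1,\dots,k_m)$ over all integers $k_1,\dots,k_m\in\{0,\dots,n\}$ with $k_1+\cdots+k_m=n$ and the sum of $q(n,k_1,\dots,k_m)$ over all integers $k_1,\dots,k_m$ with $k_1+\cdots+k_m=n$ and $\lfloor\frac nm\rfloor-\lfloor b\sqrt n\rfloor\le k_i\le\lfloor\frac nm\rfloor+\lfloor b\sqrt n\rfloor$ for $1\le i\le m-1$ is less than $\epsilon\|f\|_\infty$. The number $b_1>0$ is such that for all $b\ge b_1$, \[ \frac{\sqrt m}{(\sqrt{2\pi})^{m-1}}\int_{\mathbb{R}^{m-1}\setminus[-b\sqrt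 m,b\sqrt m]^{m-1}}e^{-\frac12\sum_{i=1}^my_i^2}\,dy_1\cdots dy_{m-1}<\epsilon,\qquad y_m:=-(y_1+\cdots+y_{m-1}). \] *)

theory Defs
  imports "HOL-Probability.Probability"
begin

definition quantile :: "'a measure \<Rightarrow> ('a \<Rightarrow> real) \<Rightarrow> real \<Rightarrow> real" where
  "quantile \<Omega> Z x = Inf {y. \<P>(\<omega> in \<Omega>. Z \<omega> \<le> y) \<ge> x}"

(* The floor selects the expansion ending in zeros at dyadic rationals. *)
definition binary_digit :: "nat \<Rightarrow> real \<Rightarrow> nat" where
  "binary_digit i x = nat (\<lfloor>2 ^ i * x\<rfloor> mod 2)"

definition haar :: "nat \<Rightarrow> nat \<Rightarrow> real \<Rightarrow> real" where
  "haar j k x =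
    (if x \<in> {real k / 2 ^ j ..< (real k + 1 / 2) / 2 ^ j} then 2 powr (real j / 2)
     else if x \<in> {(real k + 1 / 2) / 2 ^ j ..< (real k + 1) / 2 ^ j} then - (2 powr (real j / 2))
     else 0)"

(* The interval integral is over the open interval, so the values of X at 0 and 1,
   where the infimum defining a quantile function need not be a real number, do not matter. *)
definition haar_coeff :: "(real \<Rightarrow> real) \<Rightarrow> nat \<Rightarrow> nat \<Rightarrow> real" where
  "haar_coeff X j k = (LBINT x=0..1. X x * haar j k x)"

definition haar_sigma :: "(real \<Rightarrow> real) \<Rightarrow> nat \<Rightarrow> real" where
  "haar_sigma X M = sqrt (\<Sum>j=0..M. \<Sum>k=0..2 ^ j - 1. (haar_coeff X j k)\<^sup>2)"

definition haar_approx :: "(real \<Rightarrow> real) \<Rightarrow> nat \<Rightarrow> real \<Rightarrow> real" where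
  "haar_approx X M x =
    1 / haar_sigma X M *
    (\<Sum>j=0..M. 2 powr (real j / 2) * haar_coeff X j (nat \<lfloor>2 ^ j * x\<rfloor>) * (-1) ^ binary_digit (j + 1) x)"

(* v 1, ..., v m lists, in an arbitrary order, the values of g on the m intervals of
   length 1/m in (0,1). *)
definition interval_values :: "(real \<Rightarrow> real) \<Rightarrow> nat \<Rightarrow> (nat \<Rightarrow> real) \<Rightarrow> bool" where
  "interval_values g m v \<longleftrightarrow>
    (\<exists>\<pi>. bij_betw \<pi> {1..m} {0..<m} \<and>
      (\<forall>i\<in>{1..m}. \<forall>x\<in>{0<..<1} \<inter> {real (\<pi> i) / real m ..< (real (\<pi> i) + 1) / real m}. g x = v i))"

(* The multinomial coefficient n! / (k_1! ... k_m!) for real k_1, ..., k_m, with k! read as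
   Gamma (k + 1). The reciprocal Gamma function vanishes at the poles of Gamma, so the
   coefficient is 0 as soon as some k_i is a negative integer. *)
definition multinomial :: "nat \<Rightarrow> nat \<Rightarrow> (nat \<Rightarrow> real) \<Rightarrow> real" where
  "multinomial m n k = fact n * (\<Prod>i=1..m. rGamma (k i + 1))"

lemma multinomial_of_nat:
  fixes k :: "nat \<Rightarrow> nat"
  shows "multinomial m n (\<lambda>i. real (k i)) = fact n / (\<Prod>i=1..m. fact (k i))"
proof -
  have "rGamma (real (k i) + 1) = inverse (fact (k i))" for i
    using Gamma_fact[of "k i", where 'a = real]
    by (simp add: rGamma_inverse_Gamma add.commute)
  then show ?thesis
    unfolding multinomial_def by (simp add: prod_inversef[symmetric] divide_inverse comp_def)
qed

lemma multinomial_of_negative_int: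
  fixes k :: "nat \<Rightarrow> real"
  assumes "i \<in> {1..m}" and "k i = of_int l" and "l < 0"
  shows "multinomial m n k = 0"
proof -
  have "k i + 1 = of_int (l + 1)" and "l + 1 \<le> 0"
    using assms by auto
  then have "rGamma (k i + 1) = 0"
    unfolding rGamma_eq_zero_iff by (metis nonpos_Ints_of_int)
  then show ?thesis
    unfolding multinomial_def using assms(1) by auto
qed

definition q_term ::
  "(real \<Rightarrow> real) \<Rightarrow> nat \<Rightarrow> (nat \<Rightarrow> real) \<Rightarrow> nat \<Rightarrow> (nat \<Rightarrow> int) \<Rightarrow> real" where
  "q_term f m v n k =
    (1 / real m) ^ n * multinomial m n (\<lambda>i. of_int (k i)) *
    f ((\<Sum>i=1..m. of_int (k i) * v i) / sqrt (real n))"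

definition all_tuples :: "nat \<Rightarrow> nat \<Rightarrow> (nat \<Rightarrow> int) set" where
  "all_tuples m n = {k \<in> {1..m} \<rightarrow>\<^sub>E {0..int n}. (\<Sum>i=1..m. k i) = int n}"

definition central_tuples :: "nat \<Rightarrow> real \<Rightarrow> nat \<Rightarrow> (nat \<Rightarrow> int) set" where
  "central_tuples m b n =
    {k \<in> {1..m} \<rightarrow>\<^sub>E UNIV. (\<Sum>i=1..m. k i) = int n \<and>
      (\<forall>i\<in>{1..m - 1}. \<lfloor>real n / real m\<rfloor> - \<lfloor>b * sqrt (real n)\<rfloor> \<le> k i \<and>
                     k i \<le> \<lfloor>real n / real m\<rfloor> + \<lfloor>b * sqrt (real n)\<rfloor>)}"

lemma finite_central_tuples: "finite (central_tuples m b n)"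
proof (cases "m = 0")
  case True
  then show ?thesis by (auto simp: central_tuples_def)
next
  case False
  let ?I = "{1..m - 1}"
  let ?a = "\<lfloor>real n / real m\<rfloor>" and ?c = "\<lfloor>b * sqrt (real n)\<rfloor>"
  have m: "{1..m} = insert m ?I" "m \<notin> ?I" using False by auto
  have "(\<lambda>k. restrict k ?I) ` central_tuples m b n \<subseteq> ?I \<rightarrow>\<^sub>E {?a - ?c..?a + ?c}"
    by (auto simp: central_tuples_def)
  then have "finite ((\<lambda>k. restrict k ?I) ` central_tuples m b n)"
    by (rule finite_subset) (auto intro: finite_PiE)
  moreover have "inj_on (\<lambda>k. restrict k ?I) (central_tuples m b n)"
  proof (rule inj_onI)
    fix k l assume k: "k \<in> central_tuples m b n" and l: "l \<in> central_tuples m b n"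
      and eq: "restrict k ?I = restrict l ?I"
    have I: "k i = l i" if "i \<in> ?I" for i
      using fun_cong[OF eq, of i] that by simp
    have "sum k {1..m} = sum l {1..m}" using k l by (simp add: central_tuples_def)
    moreover have "sum k ?I = sum l ?I" using I by (rule sum.cong[OF refl])
    ultimately have "k m = l m" using m by simp
    then have "k i = l i" if "i \<in> {1..m}" for i
      using I[of i] that by (cases "i = m") auto
    moreover have "k \<in> {1..m} \<rightarrow>\<^sub>E UNIV" "l \<in> {1..m} \<rightarrow>\<^sub>E UNIV"
      using k l by (simp_all add: central_tuples_def)
    ultimately show "k = l" by (metis PiE_ext)
  qed
  ultimately show ?thesis by (rule finite_imageD)
qed

(* Adjoins the m-th coordinate that makes the sum of all m coordinates zero. *)
definition zero_sum_extend :: "nat \<Rightarrow> (nat \<Rightarrow> 'a::ab_group_add) \<Rightarrow> nat \<Rightarrow> 'a" where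
  "zero_sum_extend m y = y(m := - (\<Sum>i=1..m - 1. y i))"

definition gauss_tail :: "nat \<Rightarrow> real \<Rightarrow> real" where
  "gauss_tail m b =
    sqrt (real m) / sqrt (2 * pi) ^ (m - 1) *
    (LINT y:space (\<Pi>\<^sub>M i\<in>{1..m - 1}. lborel) - ({1..m - 1} \<rightarrow>\<^sub>E {- b * sqrt (real m)..b * sqrt (real m)})
      | (\<Pi>\<^sub>M i\<in>{1..m - 1}. lborel).
      exp (- 1 / 2 * (\<Sum>i=1..m. (zero_sum_extend m y i)\<^sup>2)))"

definition D :: "nat \<Rightarrow> real \<Rightarrow> nat \<Rightarrow> real" where
  "D m b n =
    (\<Sum>j \<in> {1..m - 1} \<rightarrow>\<^sub>E {- \<lfloor>b * sqrt (real n)\<rfloor>..\<lfloor>b * sqrt (real n)\<rfloor>}.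
      \<bar>1 / real m ^ n * multinomial m n (\<lambda>i. real n / real m + of_int (zero_sum_extend m j i))
       - real m powr (real m / 2) / (2 * pi * real n) powr ((real m - 1) / 2)
         * exp (- real m / 2 * (\<Sum>i=1..m. (of_int (zero_sum_extend m j i))\<^sup>2 / real n))\<bar>)"

end

theory Submission
  imports Defs "HOL-Real_Asymp.Real_Asymp"
begin

text \<open>
  Write \<open>x\<^sub>i = m j\<^sub>i / n\<close> for the relative deviations. Stirling's formula for the
  Gamma function with remainder \<open>O(1/x)\<close> turns the logarithm of the ratio of the
  multinomial probability to the Gaussian weight into
  \<open>- (n/m) \<Sum> ((1 + x\<^sub>i) ln (1 + x\<^sub>i) - x\<^sub>i - x\<^sub>i\<^sup>2/2) + O(1/n)\<close>: the linear terms cancel because the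
  deviations sum to zero, and the quadratic terms are the Gaussian exponent. In the box
  \<open>\<bar>j\<^sub>i\<bar> = O(sqrt n)\<close> the third-order Taylor term dominates and has size
  \<open>(m\<^sup>2 / (6n\<^sup>2)) \<bar>\<Sum> j\<^sub>i\<^sup>3\<bar> = O(1 / sqrt n)\<close> (\<open>ln_multinomial_over_gauss\<close>,
  \<open>eventually_multinomial_minus_gauss_le\<close>). So \<open>D\<^sub>n\<close> is, up to lower order, at most
  \<open>m\<^sup>2 / (6n\<^sup>2)\<close> times the Gaussian sum of \<open>\<Sum> \<bar>j\<^sub>i\<bar>\<^sup>3\<close> over the lattice of integer vectors with sum zero.

  That lattice sum is bounded without a multidimensional Riemann sum. Conditioning on the
  coordinates one after the other and completing the square each time reduces it to
  one-dimensional sums of shifted Gaussians over the integers, each of which exceeds the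
  corresponding integral by at most 2 (\<open>gauss_lattice_sum_le\<close>, \<open>gauss_fixed_sum_le\<close>,
  \<open>gauss_third_moment_le\<close>). Third powers are dominated by a multiple of a Gaussian factor.

  The coordinates have variance \<open>(1 - 1/m) n/m\<close> and \<open>E \<bar>g\<bar>\<^sup>3 = 2 sqrt (2/\<pi>)\<close> for a standard
  normal \<open>g\<close>, so the true size of this bound is \<open>2 m\<^bsup>3/2\<^esup> (1 - 1/m)\<^bsup>3/2\<^esup> / (3 sqrt (2 \<pi> n))\<close>,
  smaller than the claimed main term by the factor \<open>m\<^sup>2 / (m - 1)\<^bsup>3/2\<^esup>\<close>. This factor is
  at least \<open>16 / sqrt 27 > 3\<close> for \<open>m \<ge> 4\<close>. It pays for all the crude constants along the way and
  swallows every lower-order term: for all large \<open>n\<close> the main term alone bounds \<open>D\<^sub>n\<close>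
  (\<open>eventually_D_le\<close>), so the remainder can be taken to vanish eventually.
\<close>

section \<open>Stirling's formula for the Gamma function\<close>

text \<open>
  The remainder in Stirling's formula for \<open>ln x!\<close>, where \<open>x! = \<Gamma>(x + 1)\<close>.
\<close>

definition stirling_error :: "real \<Rightarrow> real" where
  "stirling_error x = ln (Gamma (x + 1)) - ((x + 1/2) * ln x - x + ln (2 * pi) / 2)"

text \<open>
  Consecutive remainders differ by \<open>(x + 1/2) ln (1 + 1/x) - 1\<close>. Comparing the integral of
  \<open>1/t\<close> over \<open>[x, x + 1]\<close> with the midpoint and the trapezoidal rule confines this difference
  to the interval from 0 to \<open>1/(4x) - 1/(4(x + 1))\<close>. Along \<open>x, x + 1, x + 2, \<dots>\<close> the remainder thus
  decreases, whereas the remainder minus \<open>1/(4x)\<close> increases; the two bounds on the remainder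
  follow once its limit is known to be 0.
\<close>

lemma stirling_error_step:
  assumes "x > 0"
  shows "stirling_error (x + 1) \<le> stirling_error x"
    and "stirling_error x - 1 / (4 * x) \<le> stirling_error (x + 1) - 1 / (4 * (x + 1))"
proof -
  have "Gamma (x + 1 + 1) = (x + 1) * Gamma (x + 1)"
    using assms by (intro Gamma_plus1) (auto elim!: nonpos_Ints_cases)
  moreover have "Gamma (x + 1) \<noteq> 0" using assms Gamma_real_pos[of "x + 1"] by linarith
  ultimately have "ln (Gamma (x + 1 + 1)) = ln (x + 1) + ln (Gamma (x + 1))"
    using assms by (simp add: ln_mult)
  then have diff: "stirling_error x - stirling_error (x + 1) = (x + 1/2) * (ln (x + 1) - ln x) - 1"
    unfolding stirling_error_def by (simp add: algebra_simps)
  have "2 * ((x + 1) - x) / (x + (x + 1)) \<le> ln (x + 1) - ln x"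
    using assms by (intro ln_inverse_approx_ge) auto
  then have "(x + 1/2) * (1 / (x + 1/2)) \<le> (x + 1/2) * (ln (x + 1) - ln x)"
    using assms by (intro mult_left_mono) (auto simp: field_simps)
  then show "stirling_error (x + 1) \<le> stirling_error x"
    using diff assms by simp
  have "ln (x + 1) - ln x \<le> 1 * (inverse x + inverse (x + 1)) / 2"
    using assms by (intro ln_inverse_approx_le) auto
  then have "(x + 1/2) * (ln (x + 1) - ln x) \<le> (x + 1/2) * ((inverse x + inverse (x + 1)) / 2)"
    using assms by (intro mult_left_mono) auto
  also have "\<dots> = 1 + 1 / (4 * x) - 1 / (4 * (x + 1))"
    using assms by (simp add: divide_simps) (simp add: algebra_simps)
  finally show "stirling_error x - 1 / (4 * x) \<le> stirling_error (x + 1) - 1 / (4 * (x + 1))"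
    using diff by simp
qed

text \<open>
  Gauss's product formula says that \<open>\<Gamma>(x + n + 1)\<close> is asymptotic to \<open>n! n\<^bsup>x\<^esup>\<close>, so the
  limit of the remainder along \<open>x + n\<close> does not depend on \<open>x\<close>.
\<close>

lemma stirling_error_shift_tendsto:
  assumes "x > 0"
  shows "(\<lambda>n. stirling_error (x + real n) - stirling_error (real n)) \<longlonglongrightarrow> 0"
proof -
  have lim: "Gamma_series x \<longlonglongrightarrow> Gamma x" by (rule Gamma_series_LIMSEQ)
  have pos: "Gamma x > 0" using assms by (rule Gamma_real_pos)
  have ser: "ln (Gamma_series x n) = ln (Gamma (real n + 1)) + x * ln (real n) + ln (Gamma x) - ln (Gamma (x + real n + 1))"
    if "n > 0" for n
  proof -
    have "pochhammer x (n + 1) = Gamma (x + of_nat (n + 1)) / Gamma x"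
      using assms by (intro pochhammer_Gamma) (auto elim!: nonpos_Ints_cases)
    then have eq: "Gamma (x + real n + 1) = Gamma x * pochhammer x (n + 1)"
      using pos by (simp add: ac_simps)
    have fact: "Gamma (real n + 1) = fact n"
      using Gamma_fact[of n, where 'a = real] by (simp add: add.commute)
    have "pochhammer x (n + 1) > 0" using assms by (intro pochhammer_pos) auto
    then show ?thesis unfolding eq fact Gamma_series_def using pos that
      by (simp add: ln_div ln_mult del: pochhammer_Suc)
  qed
  have "(\<lambda>n. ln (Gamma_series x n) - ln (Gamma x)) \<longlonglongrightarrow> ln (Gamma x) - ln (Gamma x)"
    using pos by (intro tendsto_diff tendsto_ln lim tendsto_const) (rule less_imp_neq[THEN not_sym])
  moreover have "(\<lambda>n. x * ln (real n) - (x + real n + 1/2) * ln (x + real n) + (real n + 1/2) * ln (real n) + x) \<longlonglongrightarrow> 0"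
    using assms by real_asymp
  ultimately have "(\<lambda>n. - (ln (Gamma_series x n) - ln (Gamma x)) + (x * ln (real n) - (x + real n + 1/2) * ln (x + real n) + (real n + 1/2) * ln (real n) + x)) \<longlonglongrightarrow> - (ln (Gamma x) - ln (Gamma x)) + 0"
    by (intro tendsto_add tendsto_minus)
  moreover have "eventually (\<lambda>n. - (ln (Gamma_series x n) - ln (Gamma x)) + (x * ln (real n) - (x + real n + 1/2) * ln (x + real n) + (real n + 1/2) * ln (real n) + x) =
      stirling_error (x + real n) - stirling_error (real n)) sequentially"
    using eventually_gt_at_top[of 0]
    by eventually_elim (simp add: ser stirling_error_def algebra_simps)
  ultimately show ?thesis by (simp add: tendsto_cong)
qed

lemma Gamma_legendre_duplication_real:
  fixes x :: real
  assumes "x > 0"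
  shows "Gamma x * Gamma (x + 1/2) = exp ((1 - 2 * x) * ln 2) * sqrt pi * Gamma (2 * x)"
proof -
  have "complex_of_real x \<notin> \<int>\<^sub>\<le>\<^sub>0" "complex_of_real x + 1/2 \<notin> \<int>\<^sub>\<le>\<^sub>0"
    using assms by (auto simp: complex_eq_iff elim!: nonpos_Ints_cases)
  from Gamma_legendre_duplication[OF this]
  have "Gamma (of_real x) * Gamma (of_real (x + 1/2)) =
      exp (of_real ((1 - 2 * x) * ln 2)) * of_real (sqrt pi) * Gamma (complex_of_real (2 * x))"
    by simp
  then show ?thesis
    unfolding Gamma_complex_of_real exp_of_real of_real_mult[symmetric] of_real_eq_iff .
qed

text \<open>
  The remainder has some limit \<open>L\<close> along the naturals by monotonicity, and the same limit along
  the half-integers. In the duplication formula for \<open>\<Gamma>(n) \<Gamma>(n + 1/2)\<close> two remainders stand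
  against one, and the explicit terms cancel in the limit, so \<open>L + L - L = 0\<close>. This is where
  the constant \<open>ln (2 \<pi>) / 2\<close> is determined.
\<close>

lemma stirling_error_tendsto_0: "(\<lambda>n. stirling_error (real n)) \<longlonglongrightarrow> 0"
proof -
  let ?s = "\<lambda>n. stirling_error (real (Suc n))"
  have dec: "decseq ?s"
    using stirling_error_step(1)[of "real (Suc _)"] by (intro decseq_SucI) (simp add: ac_simps)
  have "incseq (\<lambda>n. ?s n - 1 / (4 * real (Suc n)))" (is "incseq ?t")
    using stirling_error_step(2)[of "real (Suc _)"] by (intro incseq_SucI) (simp add: ac_simps)
  then have "?t 0 \<le> ?t n" for n
    by (rule incseqD) simp
  moreover have "?t n \<le> ?s n" for n by simp
  ultimately have "?t 0 \<le> ?s n" for n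
    by (meson order_trans)
  then obtain L where "?s \<longlonglongrightarrow> L"
    using decseq_convergent[OF dec] by meson
  then have L: "(\<lambda>n. stirling_error (real n)) \<longlonglongrightarrow> L"
    by (rule filterlim_sequentially_Suc[THEN iffD1])
  have "(\<lambda>n. stirling_error (1/2 + real n) - stirling_error (real n) + stirling_error (real n)) \<longlonglongrightarrow> 0 + L"
    by (intro tendsto_intros L stirling_error_shift_tendsto) auto
  then have L2: "(\<lambda>n. stirling_error (1/2 + real n)) \<longlonglongrightarrow> L" by simp
  have L3: "(\<lambda>n. stirling_error (real (2 * n))) \<longlonglongrightarrow> L"
    using LIMSEQ_subseq_LIMSEQ[OF L, of "\<lambda>n. 2 * n"] by (simp add: strict_mono_def o_def)
  have sum: "(\<lambda>n. stirling_error (real n) + stirling_error (1/2 + real n) - stirling_error (real (2 * n))) \<longlonglongrightarrow> L + L - L"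
    by (intro tendsto_intros L L2 L3)
  have null: "(\<lambda>n. real n * ln (real n) - real n * ln (real n + 1/2) + 1/2) \<longlonglongrightarrow> 0"
    by real_asymp
  have "eventually (\<lambda>n. stirling_error (real n) + stirling_error (1/2 + real n) - stirling_error (real (2 * n))
      = real n * ln (real n) - real n * ln (real n + 1/2) + 1/2) sequentially"
    using eventually_gt_at_top[of 0]
  proof eventually_elim
    case (elim n)
    have G: "ln (Gamma (x + 1)) = ln x + ln (Gamma x)" if "x > 0" for x :: real
    proof -
      have "Gamma (x + 1) = x * Gamma x" using that by (intro Gamma_plus1) (auto elim!: nonpos_Ints_cases)
      moreover have "Gamma x \<noteq> 0" using Gamma_real_pos[OF that] by linarith
      ultimately show ?thesis using that by (simp add: ln_mult)
    qed
    have "Gamma (real n) \<noteq> 0" "Gamma (real n + 1/2) \<noteq> 0" "Gamma (2 * real n) \<noteq> 0"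
      using elim by (auto intro!: less_imp_neq[THEN not_sym] Gamma_real_pos)
    then have "ln (Gamma (real n)) + ln (Gamma (real n + 1/2)) = (1 - 2 * real n) * ln 2 + ln pi / 2 + ln (Gamma (2 * real n))"
      using arg_cong[OF Gamma_legendre_duplication_real[of "real n"], of ln] elim
      by (simp add: ln_mult ln_sqrt)
    moreover have "ln (real n * 2) = ln 2 + ln (real n)" "ln (2 * real n) = ln 2 + ln (real n)"
      "ln (2 * pi) = ln 2 + ln pi" "ln (pi * 2) = ln 2 + ln pi"
      using elim by (simp_all add: ln_mult)
    ultimately show ?case
      using elim G[of "real n"] G[of "real n + 1/2"] G[of "2 * real n"]
      by (simp add: stirling_error_def field_simps)
  qed
  from LIMSEQ_unique[OF sum tendsto_cong[OF this, THEN iffD2, OF null]]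
  show ?thesis using L by simp
qed

lemma stirling_error_bounds:
  assumes "x > 0"
  shows "0 \<le> stirling_error x" and "stirling_error x \<le> 1 / (4 * x)"
proof -
  let ?s = "\<lambda>n. stirling_error (x + real n)"
  have "(\<lambda>n. ?s n - stirling_error (real n) + stirling_error (real n)) \<longlonglongrightarrow> 0 + 0"
    using assms by (intro tendsto_intros stirling_error_shift_tendsto stirling_error_tendsto_0)
  then have lim: "?s \<longlonglongrightarrow> 0" by simp
  have "decseq ?s"
    using stirling_error_step(1)[of "x + real _"] assms by (intro decseq_SucI) (simp add: ac_simps)
  from decseq_ge[OF this lim, of 0] show "0 \<le> stirling_error x" by simp
  have "(\<lambda>n. ?s n - 1 / (4 * (x + real n))) \<longlonglongrightarrow> 0 - 0"
    by (intro tendsto_diff lim) real_asymp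
  moreover have "incseq (\<lambda>n. ?s n - 1 / (4 * (x + real n)))"
    using stirling_error_step(2)[of "x + real _"] assms by (intro incseq_SucI) (simp add: ac_simps)
  ultimately have "?s 0 - 1 / (4 * (x + real 0)) \<le> 0 - 0" by (intro incseq_le) auto
  then show "stirling_error x \<le> 1 / (4 * x)" by simp
qed

section \<open>The multinomial probability against the Gaussian weight\<close>

text \<open>
  The third derivative of \<open>(1 + x) ln (1 + x)\<close> is \<open>- 1 / (1 + x)\<^sup>2\<close>, so the optimal constant at
  0 is \<open>1/6\<close>; the value \<open>7/40\<close> is what \<open>(50/49)\<^sup>2 / 6\<close> allows.
\<close>

lemma entropy_taylor_bound:
  fixes x :: real
  assumes "\<bar>x\<bar> \<le> 1/50"
  shows "\<bar>(1 + x) * ln (1 + x) - x - x\<^sup>2 / 2\<bar> \<le> 7/40 * \<bar>x\<bar> ^ 3"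
proof (cases "x = 0")
  case False
  define diff where "diff m y = (if m = 0 then (1 + y) * ln (1 + y) else if m = 1 then ln (1 + y) + 1
      else if m = 2 then 1 / (1 + y) else - 1 / (1 + y)\<^sup>2)" for m :: nat and y :: real
  have "\<exists>t. (if x < 0 then x < t \<and> t < 0 else 0 < t \<and> t < x) \<and>
      (1 + x) * ln (1 + x) = (\<Sum>m<3. diff m 0 / fact m * (x - 0) ^ m) + diff 3 t / fact 3 * (x - 0) ^ 3"
  proof (rule Taylor[where a = "-1/50" and b = "1/50"])
    show "\<forall>m t. m < 3 \<and> - 1/50 \<le> t \<and> t \<le> 1/50 \<longrightarrow> (diff m has_real_derivative diff (Suc m) t) (at t)"
    proof (intro allI impI)
      fix m :: nat and t :: real assume t: "m < 3 \<and> - 1/50 \<le> t \<and> t \<le> 1/50"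
      then consider "m = 0" | "m = 1" | "m = 2" by linarith
      then show "(diff m has_real_derivative diff (Suc m) t) (at t)"
        using t by cases (auto simp: diff_def[abs_def] power2_eq_square divide_simps intro!: derivative_eq_intros)
    qed
  qed (use False assms in \<open>auto simp: diff_def\<close>)
  then obtain t where "if x < 0 then x < t \<and> t < 0 else 0 < t \<and> t < x"
      and eq: "(1 + x) * ln (1 + x) = (\<Sum>m<3. diff m 0 / fact m * (x - 0) ^ m) + diff 3 t / fact 3 * (x - 0) ^ 3"
    by blast
  then have t: "\<bar>t\<bar> \<le> 1/50"
    using assms by (auto split: if_splits)
  have "(1 + x) * ln (1 + x) - x - x\<^sup>2 / 2 = - (1 / (1 + t)\<^sup>2 / 6) * x ^ 3"
    unfolding eq by (simp add: diff_def eval_nat_numeral)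
  then have "\<bar>(1 + x) * ln (1 + x) - x - x\<^sup>2 / 2\<bar> = 1 / (1 + t)\<^sup>2 / 6 * \<bar>x\<bar> ^ 3"
    by (simp add: abs_mult power_abs)
  also have "\<dots> \<le> 7/40 * \<bar>x\<bar> ^ 3"
  proof (rule mult_right_mono)
    have "(49/50)\<^sup>2 \<le> (1 + t)\<^sup>2" using t by (intro power_mono) auto
    then have "1 / (1 + t)\<^sup>2 \<le> 1 / (49/50)\<^sup>2" using t by (intro divide_left_mono mult_pos_pos) auto
    also have "1 / (49/50)\<^sup>2 = (2500/2401 :: real)" by (simp add: power2_eq_square)
    finally have "1 / (1 + t)\<^sup>2 / 6 \<le> 2500/2401 / 6" by (rule divide_right_mono) simp
    also have "\<dots> \<le> (7/40 :: real)" by simp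
    finally show "1 / (1 + t)\<^sup>2 / 6 \<le> 7/40" .
  qed simp
  finally show ?thesis .
qed simp

lemma abs_exp_minus_1_le:
  fixes r :: real
  assumes "\<bar>r\<bar> \<le> 1/50"
  shows "\<bar>exp r - 1\<bar> \<le> 51/50 * \<bar>r\<bar>"
proof (cases "r \<ge> 0")
  case True
  then have "exp r \<le> 1 + r + r\<^sup>2" using assms by (intro exp_bound) auto
  moreover have "r\<^sup>2 \<le> 1/50 * r" unfolding power2_eq_square
    using True assms by (intro mult_right_mono) auto
  ultimately show ?thesis using True by simp
next
  case False
  then have "\<bar>exp r - 1\<bar> = 1 - exp r" "\<bar>r\<bar> = - r" by simp_all
  moreover have "1 + r \<le> exp r" by (rule exp_ge_add_one_self)
  ultimately show ?thesis using False by linarith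
qed

definition gauss_weight :: "nat \<Rightarrow> nat \<Rightarrow> (nat \<Rightarrow> real) \<Rightarrow> real" where
  "gauss_weight m n y = real m powr (real m / 2) / (2 * pi * real n) powr ((real m - 1) / 2)
     * exp (- real m / 2 * (\<Sum>i=1..m. (y i)\<^sup>2 / real n))"

text \<open>
  The Stirling main terms of \<open>n!\<close> and of the \<open>m\<close> factorials cancel against
  the prefactor of the Gaussian weight, because the arguments \<open>n/m + y\<^sub>i\<close> add up to \<open>n\<close>. Since
  \<open>\<Sum> x\<^sub>i = 0\<close>, multiples of \<open>x\<^sub>i\<close> may be inserted freely, which exposes the Taylor remainders of
  \<open>(1 + x) ln (1 + x)\<close> and \<open>ln (1 + x)\<close>.
\<close>

lemma ln_multinomial_over_gauss:
  fixes y :: "nat \<Rightarrow> real"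
  assumes m: "m \<ge> 1" and n: "n \<ge> 1" and zero: "(\<Sum>i=1..m. y i) = 0"
    and k: "\<And>i. i \<in> {1..m} \<Longrightarrow> real n / real m + y i > 0"
  defines "x \<equiv> \<lambda>i. real m * y i / real n"
  shows "1 / real m ^ n * multinomial m n (\<lambda>i. real n / real m + y i) > 0"
    and "ln (1 / real m ^ n * multinomial m n (\<lambda>i. real n / real m + y i)) - ln (gauss_weight m n y) =
      stirling_error (real n) - (\<Sum>i=1..m. stirling_error (real n / real m + y i))
      - (\<Sum>i=1..m. real n / real m * ((1 + x i) * ln (1 + x i) - x i - (x i)\<^sup>2 / 2) + (ln (1 + x i) - x i) / 2)"
proof -
  let ?k = "\<lambda>i. real n / real m + y i"
  let ?p = "1 / real m ^ n * multinomial m n ?k"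
  have G: "Gamma (?k i + 1) > 0" if "i \<in> {1..m}" for i
    using k[OF that] by (intro Gamma_real_pos) auto
  have prod: "(\<Prod>i=1..m. rGamma (?k i + 1)) = 1 / (\<Prod>i=1..m. Gamma (?k i + 1))"
    by (simp add: rGamma_inverse_Gamma prod_inversef[symmetric] divide_inverse comp_def)
  have pos: "(\<Prod>i=1..m. Gamma (?k i + 1)) > 0" using G by (intro prod_pos) auto
  show "?p > 0" unfolding multinomial_def prod using pos m by simp
  have fact: "fact n = Gamma (real n + 1)" using Gamma_fact[of n, where 'a = real] by (simp add: add.commute)
  have Gn: "Gamma (real n + 1) > 0" by (intro Gamma_real_pos) auto
  have "?p = Gamma (real n + 1) / (real m ^ n * (\<Prod>i=1..m. Gamma (?k i + 1)))"
    unfolding multinomial_def prod fact by simp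
  then have "ln ?p = ln (Gamma (real n + 1)) - ln (real m ^ n * (\<Prod>i=1..m. Gamma (?k i + 1)))"
    using Gn pos m by (simp only:, intro ln_divide_pos mult_pos_pos) auto
  also have "ln (real m ^ n * (\<Prod>i=1..m. Gamma (?k i + 1))) = real n * ln (real m) + (\<Sum>i=1..m. ln (Gamma (?k i + 1)))"
  proof -
    have "ln (real m ^ n * (\<Prod>i=1..m. Gamma (?k i + 1))) = ln (real m ^ n) + ln (\<Prod>i=1..m. Gamma (?k i + 1))"
      using pos m by (intro ln_mult_pos) auto
    also have "ln (\<Prod>i=1..m. Gamma (?k i + 1)) = (\<Sum>i=1..m. ln (Gamma (?k i + 1)))"
      using less_imp_neq[OF G, symmetric] by (intro ln_prod) blast
    finally show ?thesis using m by (simp add: ln_realpow)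
  qed
  also have "(\<Sum>i=1..m. ln (Gamma (?k i + 1))) = (\<Sum>i=1..m. stirling_error (?k i) + ((?k i + 1/2) * ln (?k i) - ?k i + ln (2 * pi) / 2))"
    by (simp add: stirling_error_def)
  also have "\<dots> = (\<Sum>i=1..m. stirling_error (?k i)) + (\<Sum>i=1..m. (?k i + 1/2) * ln (1 + x i))
      + (\<Sum>i=1..m. ?k i + 1/2) * ln (real n / real m) - (\<Sum>i=1..m. ?k i) + real m * (ln (2 * pi) / 2)"
  proof -
    have ln: "ln (?k i) = ln (real n / real m) + ln (1 + x i)" if "i \<in> {1..m}" for i
    proof -
      have "?k i = real n / real m * (1 + x i)"
        using m n by (simp add: x_def field_simps)
      moreover from this k[OF that] have "1 + x i > 0"
        using m n by (simp add: zero_less_mult_iff zero_less_divide_iff)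
      ultimately show ?thesis using m n by (simp only:, intro ln_mult_pos) auto
    qed
    have "(\<Sum>i=1..m. stirling_error (?k i) + ((?k i + 1/2) * ln (?k i) - ?k i + ln (2 * pi) / 2)) =
       (\<Sum>i=1..m. stirling_error (?k i) + ((?k i + 1/2) * ln (1 + x i)) + ((?k i + 1/2) * ln (real n / real m)) - ?k i + ln (2 * pi) / 2)"
    proof (intro sum.cong refl)
      fix i assume i: "i \<in> {1..m}"
      show "stirling_error (?k i) + ((?k i + 1/2) * ln (?k i) - ?k i + ln (2 * pi) / 2) =
        stirling_error (?k i) + ((?k i + 1/2) * ln (1 + x i)) + ((?k i + 1/2) * ln (real n / real m)) - ?k i + ln (2 * pi) / 2"
        unfolding ln[OF i] by (simp only: distrib_left)
    qed
    then show ?thesis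
      by (simp only: sum.distrib sum_subtractf sum_distrib_right[symmetric] sum_constant card_atLeastAtMost) simp
  qed
  also have "(\<Sum>i=1..m. ?k i + 1/2) = real n + real m / 2"
    using m zero by (simp add: sum.distrib)
  also have "(\<Sum>i=1..m. ?k i) = real n"
    using m zero by (simp add: sum.distrib)
  finally have lnp: "ln ?p = ln (Gamma (real n + 1)) - (real n * ln (real m) + ((\<Sum>i=1..m. stirling_error (?k i)) +
     (\<Sum>i=1..m. (?k i + 1/2) * ln (1 + x i)) + (real n + real m / 2) * ln (real n / real m) - real n + real m * (ln (2 * pi) / 2)))" .
  have lnG: "ln (gauss_weight m n y) = real m / 2 * ln (real m) - (real m - 1) / 2 * (ln (2 * pi) + ln (real n))
      - real m / 2 * (\<Sum>i=1..m. (y i)\<^sup>2 / real n)"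
  proof -
    have "ln (gauss_weight m n y) = ln (real m powr (real m / 2) / (2 * pi * real n) powr ((real m - 1) / 2))
       + ln (exp (- real m / 2 * (\<Sum>i=1..m. (y i)\<^sup>2 / real n)))"
      unfolding gauss_weight_def using m n by (intro ln_mult_pos divide_pos_pos) auto
    also have "ln (real m powr (real m / 2) / (2 * pi * real n) powr ((real m - 1) / 2)) =
       ln (real m powr (real m / 2)) - ln ((2 * pi * real n) powr ((real m - 1) / 2))"
      using m n by (intro ln_divide_pos) auto
    also have "ln ((2 * pi * real n) powr ((real m - 1) / 2)) = (real m - 1) / 2 * ln (2 * pi * real n)"
      using n by (simp add: ln_powr)
    also have "ln (2 * pi * real n) = ln (2 * pi) + ln (real n)"
      using n by (intro ln_mult_pos) auto
    finally show ?thesis using m by (simp add: ln_powr)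
  qed
  \<comment> \<open>The two sides differ by a multiple of \<open>\<Sum> y i = 0\<close>.\<close>
  have main: "(\<Sum>i=1..m. (?k i + 1/2) * ln (1 + x i)) - real m / 2 * (\<Sum>i=1..m. (y i)\<^sup>2 / real n) =
      (\<Sum>i=1..m. real n / real m * ((1 + x i) * ln (1 + x i) - x i - (x i)\<^sup>2 / 2) + (ln (1 + x i) - x i) / 2)"
  proof -
    have "(\<Sum>i=1..m. real n / real m * ((1 + x i) * ln (1 + x i) - x i - (x i)\<^sup>2 / 2) + (ln (1 + x i) - x i) / 2)
       = (\<Sum>i=1..m. (?k i + 1/2) * ln (1 + x i) - real m / 2 * ((y i)\<^sup>2 / real n) - (1 + real m / (2 * real n)) * y i)"
    proof (intro sum.cong refl)
      fix i
      define L where "L = ln (1 + x i)"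
      show "real n / real m * ((1 + x i) * ln (1 + x i) - x i - (x i)\<^sup>2 / 2) + (ln (1 + x i) - x i) / 2 =
         (?k i + 1/2) * ln (1 + x i) - real m / 2 * ((y i)\<^sup>2 / real n) - (1 + real m / (2 * real n)) * y i"
        unfolding L_def[symmetric] using m n
        by (simp add: x_def divide_simps) (simp add: algebra_simps power2_eq_square)
    qed
    also have "\<dots> = (\<Sum>i=1..m. (?k i + 1/2) * ln (1 + x i)) - real m / 2 * (\<Sum>i=1..m. (y i)\<^sup>2 / real n)
       - (1 + real m / (2 * real n)) * (\<Sum>i=1..m. y i)"
      by (simp only: sum_subtractf sum_distrib_left)
    finally show ?thesis using zero by simp
  qed
  have lnq: "ln (real n / real m) = ln (real n) - ln (real m)" using m n by (intro ln_divide_pos) auto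
  show "ln ?p - ln (gauss_weight m n y) =
      stirling_error (real n) - (\<Sum>i=1..m. stirling_error (real n / real m + y i))
      - (\<Sum>i=1..m. real n / real m * ((1 + x i) * ln (1 + x i) - x i - (x i)\<^sup>2 / 2) + (ln (1 + x i) - x i) / 2)"
    unfolding lnp lnG main[symmetric] lnq stirling_error_def by (simp add: field_simps)
qed

text \<open>
  Only the first of the three terms on the right matters in the limit: for \<open>y\<^sub>i\<close> of order
  \<open>sqrt n\<close> it has order \<open>1 / sqrt n\<close>, the other two have order \<open>1/n\<close>.
\<close>

lemma abs_ln_multinomial_over_gauss_le:
  fixes y :: "nat \<Rightarrow> real"
  assumes m: "m \<ge> 1" and n: "n \<ge> 1" and zero: "(\<Sum>i=1..m. y i) = 0"
    and small: "\<And>i. i \<in> {1..m} \<Longrightarrow> \<bar>real m * y i / real n\<bar> \<le> 1/50"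
  shows "1 / real m ^ n * multinomial m n (\<lambda>i. real n / real m + y i) > 0"
    and "\<bar>ln (1 / real m ^ n * multinomial m n (\<lambda>i. real n / real m + y i)) - ln (gauss_weight m n y)\<bar> \<le>
      7/40 * (real m)\<^sup>2 / (real n)\<^sup>2 * (\<Sum>i=1..m. \<bar>y i\<bar> ^ 3) + ((real m)\<^sup>2 / (real n)\<^sup>2 * (\<Sum>i=1..m. (y i)\<^sup>2) + (real m)\<^sup>2 / real n)"
proof -
  define x where "x i = real m * y i / real n" for i
  let ?k = "\<lambda>i. real n / real m + y i"
  have kge: "?k i \<ge> real n / (2 * real m)" if "i \<in> {1..m}" for i
  proof -
    have "?k i = real n / real m * (1 + x i)" using m n by (simp add: x_def field_simps)
    also have "\<dots> \<ge> real n / real m * (1 / 2)"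
    proof (rule mult_left_mono)
      have "\<bar>x i\<bar> \<le> 1/50" using small[OF that] by (simp only: x_def)
      then show "1 / 2 \<le> 1 + x i" by linarith
    qed simp
    finally show ?thesis by simp
  qed
  have kpos: "?k i > 0" if "i \<in> {1..m}" for i
    using kge[OF that] m n by (smt (verit) divide_pos_pos of_nat_0_less_iff zero_less_mult_iff less_le_trans zero_less_one)
  show "1 / real m ^ n * multinomial m n ?k > 0"
    by (rule ln_multinomial_over_gauss(1)[OF m n zero kpos])
  have L: "ln (1 / real m ^ n * multinomial m n (\<lambda>i. real n / real m + y i)) - ln (gauss_weight m n y) =
      stirling_error (real n) - (\<Sum>i=1..m. stirling_error (real n / real m + y i))
      - (\<Sum>i=1..m. real n / real m * ((1 + x i) * ln (1 + x i) - x i - (x i)\<^sup>2 / 2) + (ln (1 + x i) - x i) / 2)"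
    unfolding x_def by (rule ln_multinomial_over_gauss(2)[OF m n zero kpos])
  have s1: "\<bar>stirling_error (real n)\<bar> \<le> 1 / (4 * real n)"
    using stirling_error_bounds[of "real n"] n by auto
  have s2: "\<bar>\<Sum>i=1..m. stirling_error (?k i)\<bar> \<le> real m * (real m / (2 * real n))"
  proof -
    have "\<bar>stirling_error (?k i)\<bar> \<le> real m / (2 * real n)" if "i \<in> {1..m}" for i
    proof -
      have "\<bar>stirling_error (?k i)\<bar> \<le> 1 / (4 * ?k i)"
        using stirling_error_bounds[OF kpos[OF that]] by auto
      also have "\<dots> \<le> 1 / (4 * (real n / (2 * real m)))"
        using kge[OF that] kpos[OF that] m n by (intro divide_left_mono mult_left_mono mult_pos_pos) auto
      finally show ?thesis by simp
    qed
    then have "(\<Sum>i=1..m. \<bar>stirling_error (?k i)\<bar>) \<le> (\<Sum>i=1..m. real m / (2 * real n))"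
      by (rule sum_mono)
    then show ?thesis by (intro order_trans[OF sum_abs]) simp
  qed
  have s3: "\<bar>\<Sum>i=1..m. real n / real m * ((1 + x i) * ln (1 + x i) - x i - (x i)\<^sup>2 / 2) + (ln (1 + x i) - x i) / 2\<bar>
     \<le> (\<Sum>i=1..m. 7/40 * (real m)\<^sup>2 / (real n)\<^sup>2 * \<bar>y i\<bar> ^ 3 + (real m)\<^sup>2 / (real n)\<^sup>2 * (y i)\<^sup>2)"
  proof (intro order_trans[OF sum_abs] sum_mono)
    fix i assume i: "i \<in> {1..m}"
    have xs: "\<bar>x i\<bar> \<le> 1/50" using small[OF i] by (simp add: x_def)
    have "\<bar>real n / real m * ((1 + x i) * ln (1 + x i) - x i - (x i)\<^sup>2 / 2)\<bar> \<le> real n / real m * (7/40 * \<bar>x i\<bar> ^ 3)"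
      unfolding abs_mult using entropy_taylor_bound[OF xs] by (intro mult_mono) auto
    also have "\<dots> = 7/40 * (real m)\<^sup>2 / (real n)\<^sup>2 * \<bar>y i\<bar> ^ 3"
      using m n by (simp add: x_def abs_mult power_mult_distrib power_divide) (simp add: field_simps eval_nat_numeral)
    finally have a: "\<bar>real n / real m * ((1 + x i) * ln (1 + x i) - x i - (x i)\<^sup>2 / 2)\<bar> \<le> 7/40 * (real m)\<^sup>2 / (real n)\<^sup>2 * \<bar>y i\<bar> ^ 3" .
    have "\<bar>(ln (1 + x i) - x i) / 2\<bar> \<le> (x i)\<^sup>2"
      using abs_ln_one_plus_x_minus_x_bound[of "x i"] xs by simp
    also have "\<dots> = (real m)\<^sup>2 / (real n)\<^sup>2 * (y i)\<^sup>2"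
      by (simp add: x_def power_mult_distrib power_divide)
    finally show "\<bar>real n / real m * ((1 + x i) * ln (1 + x i) - x i - (x i)\<^sup>2 / 2) + (ln (1 + x i) - x i) / 2\<bar>
       \<le> 7/40 * (real m)\<^sup>2 / (real n)\<^sup>2 * \<bar>y i\<bar> ^ 3 + (real m)\<^sup>2 / (real n)\<^sup>2 * (y i)\<^sup>2"
      using a by linarith
  qed
  have "1 / (4 * real n) + real m * (real m / (2 * real n)) \<le> (real m)\<^sup>2 / real n"
  proof -
    have "1 \<le> (real m)\<^sup>2" using m by simp
    then show ?thesis using n by (simp add: field_simps power2_eq_square)
  qed
  then show "\<bar>ln (1 / real m ^ n * multinomial m n ?k) - ln (gauss_weight m n y)\<bar> \<le>
      7/40 * (real m)\<^sup>2 / (real n)\<^sup>2 * (\<Sum>i=1..m. \<bar>y i\<bar> ^ 3) + ((real m)\<^sup>2 / (real n)\<^sup>2 * (\<Sum>i=1..m. (y i)\<^sup>2) + (real m)\<^sup>2 / real n)"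
    using L s1 s2 s3 unfolding sum.distrib sum_distrib_left[symmetric] by linarith
qed

text \<open>
  In the box all logarithmic ratios \<open>q\<close> tend to 0 uniformly, so \<open>\<bar>exp q - 1\<bar>\<close> may be replaced by
  \<open>\<bar>q\<bar>\<close> at the cost of a factor \<open>51/50\<close>; the constant \<open>357/2000\<close> is \<open>7/40\<close> times \<open>51/50\<close>, and
  exceeds the asymptotic value \<open>1/6\<close> by about 7 percent.
\<close>

lemma eventually_multinomial_minus_gauss_le:
  assumes m: "m \<ge> 1" and C: "C \<ge> 0"
  shows "eventually (\<lambda>n. \<forall>y. (\<Sum>i=1..m. y i) = 0 \<longrightarrow> (\<forall>i\<in>{1..m}. \<bar>y i\<bar> \<le> C * sqrt (real n)) \<longrightarrow>
    \<bar>1 / real m ^ n * multinomial m n (\<lambda>i. real n / real m + y i) - gauss_weight m n y\<bar> \<le>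
    gauss_weight m n y * (357/2000 * (real m)\<^sup>2 / (real n)\<^sup>2 * (\<Sum>i=1..m. \<bar>y i\<bar> ^ 3)
      + 51/50 * (real m ^ 3 * C\<^sup>2 + (real m)\<^sup>2) / real n)) sequentially"
proof -
  define K where "K = real m ^ 3 * C\<^sup>2 + (real m)\<^sup>2"
  have "(\<lambda>n. real m * C / sqrt (real n)) \<longlonglongrightarrow> 0" by real_asymp
  then have "eventually (\<lambda>n. real m * C / sqrt (real n) < 1/50) sequentially"
    by (rule order_tendstoD) simp
  moreover have "(\<lambda>n. 7/40 * real m ^ 3 * C ^ 3 / sqrt (real n) + K / real n) \<longlonglongrightarrow> 0" by real_asymp
  then have "eventually (\<lambda>n. 7/40 * real m ^ 3 * C ^ 3 / sqrt (real n) + K / real n < 1/50) sequentially"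
    by (rule order_tendstoD) simp
  ultimately show ?thesis
    using eventually_ge_at_top[of 1]
  proof (eventually_elim, intro allI impI)
    fix n :: nat and y :: "nat \<Rightarrow> real"
    assume n1: "real m * C / sqrt (real n) < 1/50"
      and n2: "7/40 * real m ^ 3 * C ^ 3 / sqrt (real n) + K / real n < 1/50" and n: "1 \<le> n"
      and zero: "(\<Sum>i=1..m. y i) = 0" and y: "\<forall>i\<in>{1..m}. \<bar>y i\<bar> \<le> C * sqrt (real n)"
    define r where "r = sqrt (real n)"
    have r: "r > 0" "real n = r\<^sup>2" using n by (auto simp: r_def)
    let ?p = "1 / real m ^ n * multinomial m n (\<lambda>i. real n / real m + y i)"
    let ?G = "gauss_weight m n y"
    let ?S = "\<Sum>i=1..m. \<bar>y i\<bar> ^ 3"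
    have small: "\<bar>real m * y i / real n\<bar> \<le> 1/50" if "i \<in> {1..m}" for i
    proof -
      have "\<bar>real m * y i / real n\<bar> \<le> real m * (C * r) / real n"
        using y that by (simp add: abs_mult r_def divide_right_mono mult_left_mono)
      also have "\<dots> = real m * C / r" using r by (simp add: power2_eq_square)
      also have "\<dots> \<le> 1/50" using n1 by (simp only: r_def)
      finally show ?thesis .
    qed
    note L = abs_ln_multinomial_over_gauss_le[OF m n zero small]
    have pos: "?p > 0" by (rule L(1))
    have Gpos: "?G > 0" using m n by (simp add: gauss_weight_def)
    define q where "q = ln ?p - ln ?G"
    have "(\<Sum>i=1..m. (y i)\<^sup>2) \<le> (\<Sum>i=1..m. (C * r)\<^sup>2)"
      using y by (intro sum_mono) (metis abs_le_square_iff abs_of_nonneg C r_def mult_nonneg_nonneg real_sqrt_ge_zero of_nat_0_le_iff)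
    then have "(real m)\<^sup>2 / (real n)\<^sup>2 * (\<Sum>i=1..m. (y i)\<^sup>2) \<le> (real m)\<^sup>2 / (real n)\<^sup>2 * (real m * (C * r)\<^sup>2)"
      by (intro mult_left_mono) auto
    also have "\<dots> = real m ^ 3 * C\<^sup>2 / real n"
      using r by (simp add: power_mult_distrib eval_nat_numeral)
    finally have "(real m)\<^sup>2 / (real n)\<^sup>2 * (\<Sum>i=1..m. (y i)\<^sup>2) + (real m)\<^sup>2 / real n \<le> K / real n"
      by (simp add: K_def add_divide_distrib)
    with L(2) have q: "\<bar>q\<bar> \<le> 7/40 * (real m)\<^sup>2 / (real n)\<^sup>2 * ?S + K / real n"
      unfolding q_def by fastforce
    have "?S \<le> (\<Sum>i=1..m. (C * r) ^ 3)"
      using y by (intro sum_mono power_mono) (auto simp: r_def)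
    then have "7/40 * (real m)\<^sup>2 / (real n)\<^sup>2 * ?S \<le> 7/40 * (real m)\<^sup>2 / (real n)\<^sup>2 * (real m * (C * r) ^ 3)"
      by (intro mult_left_mono) auto
    also have "\<dots> = 7/40 * real m ^ 3 * C ^ 3 / r"
      using r by (simp add: power_mult_distrib eval_nat_numeral)
    finally have "\<bar>q\<bar> \<le> 1/50" using q n2 unfolding r_def by linarith
    then have "\<bar>exp q - 1\<bar> \<le> 51/50 * \<bar>q\<bar>" by (rule abs_exp_minus_1_le)
    also have "\<dots> \<le> 51/50 * (7/40 * (real m)\<^sup>2 / (real n)\<^sup>2 * ?S + K / real n)"
      using q by (intro mult_left_mono) auto
    also have "\<dots> = 357/2000 * (real m)\<^sup>2 / (real n)\<^sup>2 * ?S + 51/50 * K / real n"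
      by (simp add: algebra_simps)
    finally have e: "\<bar>exp q - 1\<bar> \<le> 357/2000 * (real m)\<^sup>2 / (real n)\<^sup>2 * ?S + 51/50 * K / real n" .
    have "?p = ?G * exp q" using pos Gpos by (simp add: q_def exp_diff)
    then have "?p - ?G = ?G * (exp q - 1)" by (simp only: right_diff_distrib mult_1_right)
    then have "\<bar>?p - ?G\<bar> = ?G * \<bar>exp q - 1\<bar>"
      using Gpos by (simp only: abs_mult abs_of_pos)
    also have "\<dots> \<le> ?G * (357/2000 * (real m)\<^sup>2 / (real n)\<^sup>2 * ?S + 51/50 * K / real n)"
      using e Gpos by (intro mult_left_mono) auto
    finally show "\<bar>?p - ?G\<bar> \<le> ?G * (357/2000 * (real m)\<^sup>2 / (real n)\<^sup>2 * ?S
      + 51/50 * (real m ^ 3 * C\<^sup>2 + (real m)\<^sup>2) / real n)"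
      by (simp only: K_def)
  qed
qed

section \<open>One-dimensional Gaussian sums over the integers\<close>

lemma has_bochner_integral_gauss:
  fixes \<beta> \<theta> :: real
  assumes "\<beta> > 0"
  shows "has_bochner_integral lborel (\<lambda>x. exp (- \<beta> * (x - \<theta>)\<^sup>2)) (sqrt (pi / \<beta>))"
proof -
  define \<sigma> where "\<sigma> = 1 / sqrt (2 * \<beta>)"
  have \<sigma>: "\<sigma> > 0" "\<sigma>\<^sup>2 = 1 / (2 * \<beta>)"
    using assms by (auto simp: \<sigma>_def power_divide)
  have "has_bochner_integral lborel (normal_density \<theta> \<sigma>) 1"
    using \<sigma> by (simp add: has_bochner_integral_iff)
  then have "has_bochner_integral lborel (\<lambda>x. sqrt (pi / \<beta>) * normal_density \<theta> \<sigma> x) (sqrt (pi / \<beta>) * 1)"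
    by (rule has_bochner_integral_mult_right)
  moreover have "sqrt (pi / \<beta>) * normal_density \<theta> \<sigma> x = exp (- \<beta> * (x - \<theta>)\<^sup>2)" for x
    using assms by (simp add: normal_density_def \<sigma>(2) field_simps)
  ultimately show ?thesis by simp
qed

text \<open>
  Every integer at distance at least 1 from the centre \<open>\<theta>\<close> is charged to the unit interval
  next to it on the side of \<open>\<theta>\<close>, where the Gaussian is larger than at the integer. These
  intervals are disjoint, so the integral bounds their contribution. At most two integers are
  closer to \<open>\<theta>\<close>, and each contributes at most 1.
\<close>

lemma gauss_lattice_sum_le:
  fixes \<beta> \<theta> :: real and T :: "int set"
  assumes "\<beta> > 0" and "finite T"
  shows "(\<Sum>t\<in>T. exp (- \<beta> * (of_int t - \<theta>)\<^sup>2)) \<le> sqrt (pi / \<beta>) + 2"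
proof -
  define g where "g x = exp (- \<beta> * (x - \<theta>)\<^sup>2)" for x :: real
  define T' where "T' = {t \<in> T. \<bar>of_int t - \<theta>\<bar> \<ge> 1}"
  \<comment> \<open>The left end of the unit interval to which \<open>t\<close> is charged.\<close>
  define c where "c t = (if of_int t \<ge> \<theta> then t - 1 else t)" for t :: int
  define A where "A t = {real_of_int (c t)<..of_int (c t) + 1}" for t
  have fin: "finite T'" using assms(2) by (simp add: T'_def)
  have mono: "g (of_int t) \<le> g x" if "t \<in> T'" "x \<in> A t" for t x
  proof -
    have "(x - \<theta>)\<^sup>2 \<le> (of_int t - \<theta>)\<^sup>2"
      using that by (auto simp: T'_def A_def c_def abs_le_square_iff[symmetric] split: if_splits)
    then show ?thesis using assms(1) by (simp add: g_def)
  qed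
  have disj: "disjoint_family_on A T'"
  proof (unfold disjoint_family_on_def, intro ballI impI)
    fix t u assume tu: "t \<in> T'" "u \<in> T'" "t \<noteq> u"
    have "c t \<noteq> c u" using tu by (auto simp: T'_def c_def split: if_splits)
    then have "c t + 1 \<le> c u \<or> c u + 1 \<le> c t" by linarith
    then have "real_of_int (c t) + 1 \<le> of_int (c u) \<or> real_of_int (c u) + 1 \<le> of_int (c t)"
      by linarith
    then show "A t \<inter> A u = {}" by (auto simp: A_def)
  qed
  have le: "(\<Sum>t\<in>T'. indicator (A t) x * g (of_int t)) \<le> g x" for x
  proof -
    have "(\<Sum>t\<in>T'. indicator (A t) x * g (of_int t)) \<le> (\<Sum>t\<in>T'. indicator (A t) x * g x)"
      using mono by (intro sum_mono) (auto simp: indicator_def)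
    also have "\<dots> = indicator (\<Union>t\<in>T'. A t) x * g x"
      by (simp only: indicator_UN_disjoint[OF fin disj, of x] sum_distrib_right)
    also have "\<dots> \<le> g x" by (simp add: indicator_def g_def)
    finally show ?thesis .
  qed
  have sum: "has_bochner_integral lborel (\<lambda>x. \<Sum>t\<in>T'. indicator (A t) x * g (of_int t))
      (\<Sum>t\<in>T'. 1 * g (of_int t))"
  proof (intro has_bochner_integral_sum has_bochner_integral_mult_left)
    fix t
    have "has_bochner_integral lborel (indicator (A t)) (measure lborel (A t))"
      by (rule has_bochner_integral_real_indicator) (auto simp: A_def)
    then show "has_bochner_integral lborel (indicator (A t)) (1::real)" by (simp add: A_def)
  qed
  have "has_bochner_integral lborel g (sqrt (pi / \<beta>))"
    unfolding g_def[abs_def] using assms(1) by (rule has_bochner_integral_gauss)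
  with sum integral_mono[OF integrable.intros[OF sum] integrable.intros[OF this] le]
  have far: "(\<Sum>t\<in>T'. g (of_int t)) \<le> sqrt (pi / \<beta>)"
    by (simp add: has_bochner_integral_integral_eq)
  have "T - T' \<subseteq> {\<lfloor>\<theta>\<rfloor>, \<lfloor>\<theta>\<rfloor> + 1}"
    by (auto simp: T'_def) linarith
  then have "card (T - T') \<le> card {\<lfloor>\<theta>\<rfloor>, \<lfloor>\<theta>\<rfloor> + 1}"
    by (intro card_mono) auto
  also have "\<dots> = 2" by simp
  finally have "real (card (T - T')) * 1 \<le> 2" by simp
  moreover have "(\<Sum>t\<in>T - T'. g (of_int t)) \<le> real (card (T - T')) * 1"
    using assms(1) by (intro sum_bounded_above) (simp add: g_def)
  moreover have "(\<Sum>t\<in>T. g (of_int t)) = (\<Sum>t\<in>T - T'. g (of_int t)) + (\<Sum>t\<in>T'. g (of_int t))"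
    using assms(2) by (intro sum.subset_diff) (auto simp: T'_def)
  ultimately show ?thesis using far by (simp add: g_def)
qed

text \<open>
  The constant is the maximum of \<open>\<bar>u\<bar>\<^sup>3 exp (- l u\<^sup>2)\<close>. It comes from the tangent bound
  \<open>t \<le> exp (t - 1)\<close> at \<open>t = 2 l u\<^sup>2 / 3\<close>.
\<close>

lemma cube_le_exp_square:
  fixes l u :: real
  assumes "l > 0"
  shows "\<bar>u\<bar> ^ 3 \<le> sqrt ((3 / (2 * l * exp 1)) ^ 3) * exp (l * u\<^sup>2)"
proof (rule power2_le_imp_le)
  have "2 * l / 3 * u\<^sup>2 \<le> exp (2 * l / 3 * u\<^sup>2 - 1)"
    using exp_ge_add_one_self[of "2 * l / 3 * u\<^sup>2 - 1"] by simp
  also have "\<dots> = exp (2 * l / 3 * u\<^sup>2) / exp 1"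
    by (rule exp_diff)
  finally have "u\<^sup>2 \<le> 3 / (2 * l * exp 1) * exp (2 * l / 3 * u\<^sup>2)"
    using assms by (simp add: field_simps)
  then have "(u\<^sup>2) ^ 3 \<le> (3 / (2 * l * exp 1) * exp (2 * l / 3 * u\<^sup>2)) ^ 3"
    by (intro power_mono) auto
  also have "\<dots> = (3 / (2 * l * exp 1)) ^ 3 * (exp (l * u\<^sup>2))\<^sup>2"
    unfolding power_mult_distrib exp_of_nat_mult[symmetric] by (simp add: algebra_simps)
  finally show "(\<bar>u\<bar> ^ 3)\<^sup>2 \<le> (sqrt ((3 / (2 * l * exp 1)) ^ 3) * exp (l * u\<^sup>2))\<^sup>2"
    using assms by (simp add: power_mult_distrib power_even_abs flip: power_mult)
  show "0 \<le> sqrt ((3 / (2 * l * exp 1)) ^ 3) * exp (l * u\<^sup>2)"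
    using assms by simp
qed

definition gauss_cubic_bound :: "real \<Rightarrow> real" where
  "gauss_cubic_bound \<beta> = sqrt ((2 / (\<beta> * exp 1)) ^ 3) * (2 * sqrt (pi / \<beta>) + 2)"

text \<open>
  Trading \<open>\<bar>t\<bar>\<^sup>3\<close> for the factor \<open>exp (3 \<beta> t\<^sup>2 / 4)\<close> leaves a pure Gaussian sum with parameter
  \<open>\<beta>/4\<close>; the share \<open>3/4\<close> minimises the resulting constant. The leading term
  is \<open>2 sqrt \<pi> (2 / e)\<^bsup>3/2\<^esup> / \<beta>\<^sup>2\<close>, about \<open>2.24\<close> times the integral \<open>1/\<beta>\<^sup>2\<close> of the summand.
\<close>

lemma gauss_cubic_lattice_sum_le:
  fixes \<beta> :: real and T :: "int set"
  assumes "\<beta> > 0" and "finite T"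
  shows "(\<Sum>t\<in>T. \<bar>of_int t\<bar> ^ 3 * exp (- \<beta> * (of_int t)\<^sup>2)) \<le>
    sqrt ((2 / (\<beta> * exp 1)) ^ 3) * (2 * sqrt (pi / \<beta>) + 2)"
proof -
  define C where "C = sqrt ((2 / (\<beta> * exp 1)) ^ 3)"
  have "C \<ge> 0" using assms by (simp add: C_def)
  have "(\<Sum>t\<in>T. \<bar>of_int t\<bar> ^ 3 * exp (- \<beta> * (of_int t)\<^sup>2)) \<le>
      (\<Sum>t\<in>T. C * exp (- (\<beta> / 4) * (of_int t - 0)\<^sup>2))"
  proof (rule sum_mono)
    fix t
    have "\<bar>of_int t\<bar> ^ 3 \<le> C * exp (3 * \<beta> / 4 * (of_int t)\<^sup>2)"
      using cube_le_exp_square[of "3 * \<beta> / 4" "of_int t"] assms by (simp add: C_def)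
    then have "\<bar>of_int t\<bar> ^ 3 * exp (- \<beta> * (of_int t)\<^sup>2)
        \<le> C * exp (3 * \<beta> / 4 * (of_int t)\<^sup>2) * exp (- \<beta> * (of_int t)\<^sup>2)"
      by (rule mult_right_mono) simp
    also have "\<dots> = C * exp (- (\<beta> / 4) * (of_int t - 0)\<^sup>2)"
      unfolding mult.assoc exp_add[symmetric] by (simp add: algebra_simps)
    finally show "\<bar>of_int t\<bar> ^ 3 * exp (- \<beta> * (of_int t)\<^sup>2) \<le> C * exp (- (\<beta> / 4) * (of_int t - 0)\<^sup>2)" .
  qed
  also have "\<dots> \<le> C * (sqrt (pi / (\<beta> / 4)) + 2)"
    unfolding sum_distrib_left[symmetric]
    using assms \<open>C \<ge> 0\<close> by (intro mult_left_mono gauss_lattice_sum_le) auto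
  also have "sqrt (pi / (\<beta> / 4)) = 2 * sqrt (pi / \<beta>)"
    by (simp add: real_sqrt_divide real_sqrt_mult)
  finally show ?thesis by (simp add: C_def)
qed

section \<open>Gaussian sums over integer vectors with prescribed sum\<close>

lemma sum_PiE_insert:
  assumes "x \<notin> I"
  shows "(\<Sum>j\<in>insert x I \<rightarrow>\<^sub>E T. h j) = (\<Sum>t\<in>T. \<Sum>j\<in>I \<rightarrow>\<^sub>E T. h (j(x := t)))"
proof -
  have "(\<Sum>j\<in>insert x I \<rightarrow>\<^sub>E T. h j) = (\<Sum>(t, j)\<in>T \<times> (I \<rightarrow>\<^sub>E T). h (j(x := t)))"
    unfolding PiE_insert_eq using inj_combinator[OF assms, of "\<lambda>_. T"]
    by (subst sum.reindex) (auto simp: case_prod_beta)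
  then show ?thesis by (simp add: sum.cartesian_product)
qed

text \<open>
  Without the summands 2 the product telescopes to \<open>(\<pi>/\<alpha>)\<^bsup>k/2\<^esup> / sqrt (k + 1)\<close>, the integral
  of \<open>exp (- \<alpha> (\<Sum> y\<^sub>i\<^sup>2 + (\<Sum> y\<^sub>i)\<^sup>2))\<close> over the \<open>k\<close>-dimensional space. The summand 2 in each factor
  is the error of \<open>gauss_lattice_sum_le\<close>.
\<close>

definition gauss_norm :: "real \<Rightarrow> nat \<Rightarrow> real" where
  "gauss_norm \<alpha> k = (\<Prod>i=1..k. sqrt (pi * real i / (\<alpha> * (real i + 1))) + 2)"

lemma gauss_norm_nonneg: "\<alpha> > 0 \<Longrightarrow> gauss_norm \<alpha> k \<ge> 0"
  by (auto simp: gauss_norm_def intro!: prod_nonneg)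

text \<open>
  The vectors \<open>j\<close> on \<open>I\<close> stand for the integer vectors with one more coordinate and total \<open>s\<close>.
  Among real vectors with \<open>k\<close> coordinates and total \<open>s\<close> the smallest sum of squares is \<open>s\<^sup>2/k\<close>,
  which explains the exponential on the right. For the induction, split off one coordinate \<open>t\<close>:
  completing the square gives, with \<open>k = card I + 1\<close> before the insertion,
  \<open>t\<^sup>2 + (s - t)\<^sup>2/k = ((k + 1)/k) (t - s/(k + 1))\<^sup>2 + s\<^sup>2/(k + 1)\<close>,
  so the sum over \<open>t\<close> is a shifted Gaussian sum and contributes the next factor of \<open>gauss_norm\<close>.
\<close>

lemma gauss_fixed_sum_le:
  fixes \<alpha> s :: real and T :: "int set"
  assumes "\<alpha> > 0" and "finite T" and "finite I"
  shows "(\<Sum>j\<in>I \<rightarrow>\<^sub>E T. exp (- \<alpha> * ((\<Sum>i\<in>I. (of_int (j i))\<^sup>2) + (s - (\<Sum>i\<in>I. of_int (j i)))\<^sup>2)))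
    \<le> gauss_norm \<alpha> (card I) * exp (- \<alpha> * s\<^sup>2 / (real (card I) + 1))"
  using \<open>finite I\<close>
proof (induction I arbitrary: s rule: finite_induct)
  case empty
  then show ?case by (simp add: gauss_norm_def)
next
  case (insert x I)
  define k where "k = real (card I) + 1"
  have k: "k \<ge> 1" by (simp add: k_def)
  have "(\<Sum>j\<in>insert x I \<rightarrow>\<^sub>E T. exp (- \<alpha> * ((\<Sum>i\<in>insert x I. (of_int (j i))\<^sup>2) + (s - (\<Sum>i\<in>insert x I. of_int (j i)))\<^sup>2)))
     = (\<Sum>t\<in>T. \<Sum>j\<in>I \<rightarrow>\<^sub>E T. exp (- \<alpha> * (of_int t)\<^sup>2) *
          exp (- \<alpha> * ((\<Sum>i\<in>I. (of_int (j i))\<^sup>2) + ((s - of_int t) - (\<Sum>i\<in>I. of_int (j i)))\<^sup>2)))"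
    unfolding sum_PiE_insert[OF insert.hyps(2)]
  proof (intro sum.cong refl)
    fix t j
    have "(\<Sum>i\<in>I. (real_of_int ((j(x := t)) i))\<^sup>2) = (\<Sum>i\<in>I. (real_of_int (j i))\<^sup>2)"
      "(\<Sum>i\<in>I. real_of_int ((j(x := t)) i)) = (\<Sum>i\<in>I. real_of_int (j i))"
      using insert.hyps(2) by (auto intro!: sum.cong)
    then show "exp (- \<alpha> * ((\<Sum>i\<in>insert x I. (of_int ((j(x := t)) i))\<^sup>2) + (s - (\<Sum>i\<in>insert x I. of_int ((j(x := t)) i)))\<^sup>2))
       = exp (- \<alpha> * (of_int t)\<^sup>2) *
          exp (- \<alpha> * ((\<Sum>i\<in>I. (of_int (j i))\<^sup>2) + ((s - of_int t) - (\<Sum>i\<in>I. of_int (j i)))\<^sup>2))"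
      unfolding exp_add[symmetric] using insert.hyps by (simp add: algebra_simps)
  qed
  also have "\<dots> \<le> (\<Sum>t\<in>T. exp (- \<alpha> * (of_int t)\<^sup>2) *
      (gauss_norm \<alpha> (card I) * exp (- \<alpha> * (s - of_int t)\<^sup>2 / k)))"
    unfolding sum_distrib_left[symmetric] k_def
    by (intro sum_mono mult_left_mono insert.IH) auto
  also have "\<dots> = (\<Sum>t\<in>T. gauss_norm \<alpha> (card I) * exp (- \<alpha> * s\<^sup>2 / (k + 1)) *
      exp (- (\<alpha> * (k + 1) / k) * (of_int t - s / (k + 1))\<^sup>2))"
  proof (intro sum.cong refl)
    fix t :: int
    have "- \<alpha> * (of_int t)\<^sup>2 + - \<alpha> * (s - of_int t)\<^sup>2 / k =
        - \<alpha> * s\<^sup>2 / (k + 1) + - (\<alpha> * (k + 1) / k) * (of_int t - s / (k + 1))\<^sup>2"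
      using k by (simp add: divide_simps) (simp add: algebra_simps power2_eq_square)
    then have "exp (- \<alpha> * (of_int t)\<^sup>2) * exp (- \<alpha> * (s - of_int t)\<^sup>2 / k) =
       exp (- \<alpha> * s\<^sup>2 / (k + 1)) * exp (- (\<alpha> * (k + 1) / k) * (of_int t - s / (k + 1))\<^sup>2)"
      by (simp only: exp_add[symmetric])
    then show "exp (- \<alpha> * (of_int t)\<^sup>2) * (gauss_norm \<alpha> (card I) * exp (- \<alpha> * (s - of_int t)\<^sup>2 / k)) =
      gauss_norm \<alpha> (card I) * exp (- \<alpha> * s\<^sup>2 / (k + 1)) * exp (- (\<alpha> * (k + 1) / k) * (of_int t - s / (k + 1))\<^sup>2)"
      by (simp add: algebra_simps)
  qed
  also have "\<dots> \<le> gauss_norm \<alpha> (card I) * exp (- \<alpha> * s\<^sup>2 / (k + 1)) * (sqrt (pi / (\<alpha> * (k + 1) / k)) + 2)"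
    unfolding sum_distrib_left[symmetric] using assms k
    by (intro mult_left_mono gauss_lattice_sum_le mult_nonneg_nonneg gauss_norm_nonneg) auto
  also have "\<dots> = gauss_norm \<alpha> (card (insert x I)) * exp (- \<alpha> * s\<^sup>2 / (real (card (insert x I)) + 1))"
    using insert.hyps by (simp add: gauss_norm_def k_def add.commute)
  finally show ?case .
qed

text \<open>
  Fixing the coordinate \<open>u\<close> that carries the third power leaves a Gaussian sum over the vectors
  with total \<open>- u\<close>, which decays like \<open>exp (- \<alpha> u\<^sup>2 / (card I + 1))\<close>; together with \<open>exp (- \<alpha> u\<^sup>2)\<close>
  this is the parameter of the cubic sum.
\<close>

lemma gauss_cubic_fixed_sum_le:
  fixes \<alpha> :: real and T U :: "int set"
  assumes \<alpha>: "\<alpha> > 0" and "finite T" and "finite U" and "finite I"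
  shows "(\<Sum>u\<in>U. \<Sum>j\<in>I \<rightarrow>\<^sub>E T. \<bar>of_int u\<bar> ^ 3 *
      exp (- \<alpha> * ((of_int u)\<^sup>2 + (\<Sum>i\<in>I. (of_int (j i))\<^sup>2) + (of_int u + (\<Sum>i\<in>I. of_int (j i)))\<^sup>2)))
    \<le> gauss_norm \<alpha> (card I) * gauss_cubic_bound (\<alpha> * (real (card I) + 2) / (real (card I) + 1))"
proof -
  define k where "k = real (card I) + 1"
  have k: "k \<ge> 1" by (simp add: k_def)
  define \<beta> where "\<beta> = \<alpha> * (k + 1) / k"
  have \<beta>: "\<beta> > 0" using \<alpha> k by (simp add: \<beta>_def)
  have "(\<Sum>u\<in>U. \<Sum>j\<in>I \<rightarrow>\<^sub>E T. \<bar>of_int u\<bar> ^ 3 *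
      exp (- \<alpha> * ((of_int u)\<^sup>2 + (\<Sum>i\<in>I. (of_int (j i))\<^sup>2) + (of_int u + (\<Sum>i\<in>I. of_int (j i)))\<^sup>2)))
    = (\<Sum>u\<in>U. \<bar>of_int u\<bar> ^ 3 * exp (- \<alpha> * (of_int u)\<^sup>2) * (\<Sum>j\<in>I \<rightarrow>\<^sub>E T.
      exp (- \<alpha> * ((\<Sum>i\<in>I. (of_int (j i))\<^sup>2) + (- of_int u - (\<Sum>i\<in>I. of_int (j i)))\<^sup>2))))"
    unfolding sum_distrib_left mult.assoc exp_add[symmetric]
    by (intro sum.cong refl arg_cong2[where f = "(*)"] arg_cong[where f = exp])
       (simp add: algebra_simps power2_eq_square)
  also have "\<dots> \<le> (\<Sum>u\<in>U. \<bar>of_int u\<bar> ^ 3 * exp (- \<alpha> * (of_int u)\<^sup>2) *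
      (gauss_norm \<alpha> (card I) * exp (- \<alpha> * (- of_int u)\<^sup>2 / (real (card I) + 1))))"
    using assms by (intro sum_mono mult_left_mono gauss_fixed_sum_le) auto
  also have "\<dots> = gauss_norm \<alpha> (card I) * (\<Sum>u\<in>U. \<bar>of_int u\<bar> ^ 3 * exp (- \<beta> * (of_int u)\<^sup>2))"
    unfolding sum_distrib_left
  proof (intro sum.cong refl)
    fix u :: int
    have "- \<beta> * (of_int u)\<^sup>2 = - \<alpha> * (of_int u)\<^sup>2 + - \<alpha> * (- of_int u)\<^sup>2 / (real (card I) + 1)"
      using k unfolding k_def[symmetric] by (simp add: \<beta>_def field_simps)
    then show "\<bar>of_int u\<bar> ^ 3 * exp (- \<alpha> * (of_int u)\<^sup>2) *
      (gauss_norm \<alpha> (card I) * exp (- \<alpha> * (- of_int u)\<^sup>2 / (real (card I) + 1))) =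
      gauss_norm \<alpha> (card I) * (\<bar>of_int u\<bar> ^ 3 * exp (- \<beta> * (of_int u)\<^sup>2))"
      by (simp only: exp_add) (simp add: algebra_simps)
  qed
  also have "\<dots> \<le> gauss_norm \<alpha> (card I) * gauss_cubic_bound \<beta>"
    unfolding gauss_cubic_bound_def using \<beta> assms
    by (intro mult_left_mono gauss_cubic_lattice_sum_le gauss_norm_nonneg) auto
  also have "\<beta> = \<alpha> * (real (card I) + 2) / (real (card I) + 1)"
    by (simp add: \<beta>_def k_def)
  finally show ?thesis .
qed

text \<open>
  The zero-sum condition makes \<open>- \<Sum> j\<^sub>i\<close> a coordinate on a par with the others. For its third
  moment, exchange it with the coordinate \<open>l\<close> by the substitution \<open>u = - (t + \<Sum> j\<^sub>i)\<close>. The new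
  coordinate leaves the range \<open>T\<close>, but as all terms are nonnegative the sum may be
  extended to any finite set \<open>U\<close> that contains all the values of \<open>u\<close>.
\<close>

lemma gauss_third_moment_le:
  fixes \<alpha> :: real and T :: "int set"
  assumes \<alpha>: "\<alpha> > 0" and T: "finite T" and I: "finite I" and l: "l \<in> I"
  defines "W \<equiv> \<lambda>j. exp (- \<alpha> * ((\<Sum>i\<in>I. (real_of_int (j i))\<^sup>2) + (\<Sum>i\<in>I. of_int (j i))\<^sup>2))"
    and "K \<equiv> gauss_norm \<alpha> (card I - 1) * gauss_cubic_bound (\<alpha> * (real (card I) + 1) / real (card I))"
  shows "(\<Sum>j\<in>I \<rightarrow>\<^sub>E T. \<bar>of_int (j l)\<bar> ^ 3 * W j) \<le> K"
    and "(\<Sum>j\<in>I \<rightarrow>\<^sub>E T. \<bar>\<Sum>i\<in>I. of_int (j i)\<bar> ^ 3 * W j) \<le> K"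
proof -
  define J where "J = I - {l}"
  have J: "finite J" "l \<notin> J" "insert l J = I" "card I = Suc (card J)"
    using I l card.remove[OF I l] by (auto simp: J_def)
  have K: "K = gauss_norm \<alpha> (card J) * gauss_cubic_bound (\<alpha> * (real (card J) + 2) / (real (card J) + 1))"
    unfolding K_def J(4) by (simp add: algebra_simps)
  define w where "w u j = \<bar>of_int u\<bar> ^ 3 *
      exp (- \<alpha> * ((of_int u)\<^sup>2 + (\<Sum>i\<in>J. (of_int (j i))\<^sup>2) + (of_int u + (\<Sum>i\<in>J. of_int (j i)))\<^sup>2))"
    for u :: int and j :: "'a \<Rightarrow> int"
  have upd: "(\<Sum>i\<in>I. f (of_int ((j(l := t)) i))) = f (real_of_int t) + (\<Sum>i\<in>J. f (of_int (j i)))"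
    for f :: "real \<Rightarrow> real" and j t
  proof -
    have "(\<Sum>i\<in>J. f (of_int ((j(l := t)) i))) = (\<Sum>i\<in>J. f (of_int (j i)))"
      using J(2) by (auto intro!: sum.cong)
    then show ?thesis unfolding J(3)[symmetric] using J(1,2) by simp
  qed
  have Wupd: "W (j(l := t)) = exp (- \<alpha> * ((of_int t)\<^sup>2 + (\<Sum>i\<in>J. (of_int (j i))\<^sup>2) + (of_int t + (\<Sum>i\<in>J. of_int (j i)))\<^sup>2))"
    for j t
    unfolding W_def upd[of "\<lambda>x. x\<^sup>2"] upd[of "\<lambda>x. x"] by simp
  have "(\<Sum>j\<in>I \<rightarrow>\<^sub>E T. \<bar>of_int (j l)\<bar> ^ 3 * W j) = (\<Sum>t\<in>T. \<Sum>j\<in>J \<rightarrow>\<^sub>E T. w t j)"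
    unfolding J(3)[symmetric] sum_PiE_insert[OF J(2)] by (simp add: Wupd w_def)
  also have "\<dots> \<le> K"
    unfolding K w_def by (intro gauss_cubic_fixed_sum_le \<alpha> T J(1))
  finally show "(\<Sum>j\<in>I \<rightarrow>\<^sub>E T. \<bar>of_int (j l)\<bar> ^ 3 * W j) \<le> K" .

  define \<phi> where "\<phi> j t = - (t + (\<Sum>i\<in>J. j i))" for j :: "'a \<Rightarrow> int" and t
  define U where "U = (\<Union>j\<in>J \<rightarrow>\<^sub>E T. \<phi> j ` T)"
  have U: "finite U" using T J(1) by (auto simp: U_def intro!: finite_PiE)
  have "(\<Sum>j\<in>I \<rightarrow>\<^sub>E T. \<bar>\<Sum>i\<in>I. of_int (j i)\<bar> ^ 3 * W j) = (\<Sum>t\<in>T. \<Sum>j\<in>J \<rightarrow>\<^sub>E T. w (\<phi> j t) j)"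
    unfolding J(3)[symmetric] sum_PiE_insert[OF J(2)] unfolding J(3)
  proof (intro sum.cong refl)
    fix t j
    have eq: "of_int (\<phi> j t) = - (of_int t + (\<Sum>i\<in>J. real_of_int (j i)))" by (simp add: \<phi>_def)
    \<comment> \<open>The exponent is symmetric in the two coordinates that are exchanged.\<close>
    have swap: "\<bar>s\<bar> ^ 3 * exp (- \<alpha> * (x\<^sup>2 + q + s\<^sup>2)) = \<bar>- s\<bar> ^ 3 * exp (- \<alpha> * ((- s)\<^sup>2 + q + (- s + p)\<^sup>2))"
      if "s = x + p" for s x p q :: real
    proof -
      have "- s + p = - x" using that by simp
      then show ?thesis by (simp add: add_ac)
    qed
    show "\<bar>\<Sum>i\<in>I. of_int ((j(l := t)) i)\<bar> ^ 3 * W (j(l := t)) = w (\<phi> j t) j"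
      unfolding w_def Wupd upd[of "\<lambda>x. x"] eq by (rule swap) (rule refl)
  qed
  also have "\<dots> = (\<Sum>j\<in>J \<rightarrow>\<^sub>E T. \<Sum>t\<in>T. w (\<phi> j t) j)" by (rule sum.swap)
  also have "\<dots> = (\<Sum>j\<in>J \<rightarrow>\<^sub>E T. \<Sum>u\<in>\<phi> j ` T. w u j)"
  proof (rule sum.cong[OF refl])
    show "(\<Sum>t\<in>T. w (\<phi> j t) j) = (\<Sum>u\<in>\<phi> j ` T. w u j)" for j
      by (subst sum.reindex) (auto simp: \<phi>_def inj_on_def)
  qed
  also have "\<dots> \<le> (\<Sum>j\<in>J \<rightarrow>\<^sub>E T. \<Sum>u\<in>U. w u j)"
    using U by (intro sum_mono sum_mono2) (auto simp: U_def w_def)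
  also have "\<dots> = (\<Sum>u\<in>U. \<Sum>j\<in>J \<rightarrow>\<^sub>E T. w u j)" by (rule sum.swap)
  also have "\<dots> \<le> K"
    unfolding K w_def by (intro gauss_cubic_fixed_sum_le \<alpha> T U J(1))
  finally show "(\<Sum>j\<in>I \<rightarrow>\<^sub>E T. \<bar>\<Sum>i\<in>I. of_int (j i)\<bar> ^ 3 * W j) \<le> K" .
qed

section \<open>Size of the resulting bound\<close>

lemma prod_consecutive_ratio: "(\<Prod>i=1..k. real i / (real i + 1)) = 1 / (real k + 1)"
  by (induction k) (auto simp: field_simps)

lemma gauss_norm_scale:
  assumes "n \<ge> 1" "m \<ge> 1"
  shows "gauss_norm (real m / (2 * real n)) k =
    sqrt (real n) ^ k * (\<Prod>i=1..k. sqrt (2 * pi / real m * (real i / (real i + 1))) + 2 * (1 / sqrt (real n)))"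
proof -
  have "sqrt (pi * real i / (real m / (2 * real n) * (real i + 1))) + 2 =
     sqrt (real n) * (sqrt (2 * pi / real m * (real i / (real i + 1))) + 2 * (1 / sqrt (real n)))" for i
  proof -
    have "pi * real i / (real m / (2 * real n) * (real i + 1)) = real n * (2 * pi / real m * (real i / (real i + 1)))"
      using assms by (simp add: field_simps)
    then show ?thesis using assms by (simp only: real_sqrt_mult distrib_left) simp
  qed
  then show ?thesis by (simp add: gauss_norm_def prod.distrib)
qed

lemma gauss_cubic_bound_scale:
  assumes "n \<ge> 1"
  shows "gauss_cubic_bound (\<gamma> / real n) =
    sqrt (real n) ^ 4 * (sqrt ((2 / (\<gamma> * exp 1)) ^ 3) * (2 * sqrt (pi / \<gamma>) + 2 * (1 / sqrt (real n))))"
proof -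
  have "(2 / (\<gamma> / real n * exp 1)) ^ 3 = real n ^ 3 * (2 / (\<gamma> * exp 1)) ^ 3"
    using assms by (simp add: power_divide power_mult_distrib)
  then have root: "sqrt ((2 / (\<gamma> / real n * exp 1)) ^ 3) = sqrt (real n) ^ 3 * sqrt ((2 / (\<gamma> * exp 1)) ^ 3)"
    by (simp only: real_sqrt_mult real_sqrt_power)
  have "pi / (\<gamma> / real n) = real n * (pi / \<gamma>)" by simp
  then have "sqrt (pi / (\<gamma> / real n)) = sqrt (real n) * sqrt (pi / \<gamma>)"
    by (simp only: real_sqrt_mult)
  then have sum: "2 * sqrt (pi / (\<gamma> / real n)) + 2 = sqrt (real n) * (2 * sqrt (pi / \<gamma>) + 2 * (1 / sqrt (real n)))"
    using assms by (simp add: algebra_simps)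
  have "r ^ 3 * a * (r * c) = r ^ 4 * (a * c)" for r a c :: real
    by (simp add: eval_nat_numeral)
  then show ?thesis
    unfolding gauss_cubic_bound_def root sum .
qed

lemma gauss_prefactor_eq:
  assumes "m \<ge> 1" "n \<ge> 1"
  shows "real m powr (real m / 2) / (2 * pi * real n) powr ((real m - 1) / 2) =
    sqrt (real m ^ m) / sqrt (2 * pi) ^ (m - 1) / sqrt (real n) ^ (m - 1)"
proof -
  have half: "x powr (real k / 2) = sqrt x ^ k" if "x > 0" for x :: real and k
    using that by (simp add: powr_half_sqrt[symmetric] powr_realpow[symmetric] powr_powr)
  have "(real m - 1) / 2 = real (m - 1) / 2" using assms by simp
  then show ?thesis
    using half[of "real m" m] half[of "2 * pi * real n" "m - 1"] assms
    by (simp add: real_sqrt_mult power_mult_distrib real_sqrt_power)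
qed

lemma exp_1_cubed_ge: "exp 1 ^ 3 \<ge> (18 :: real)"
proof -
  \<comment> \<open>\<open>13/8\<close> is the second Taylor polynomial of \<open>exp\<close> at \<open>1/2\<close>.\<close>
  have "(13/8)\<^sup>2 \<le> (exp (1/2 :: real))\<^sup>2"
    using exp_lower_Taylor_quadratic[of "1/2::real"] by (intro power_mono) (auto simp: power2_eq_square)
  also have "\<dots> = exp (1::real)" by (simp add: exp_double[symmetric])
  finally have "(13/8)\<^sup>2 ^ 3 \<le> exp (1::real) ^ 3" by (intro power_mono) auto
  moreover have "(18::real) \<le> (13/8)\<^sup>2 ^ 3" by (simp add: eval_nat_numeral)
  ultimately show ?thesis by linarith
qed

text \<open>
  This is how the main term with \<open>m\<^sup>2\<close> beats the Gaussian third moment with \<open>(m - 1)\<^bsup>3/2\<^esup>\<close>. The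
  smallest value of \<open>m\<^sup>4 / (m - 1)\<^sup>3\<close> is \<open>256/27\<close>, attained at \<open>m = 4\<close>.
\<close>

lemma nine_cubes_less_fourth_power:
  assumes "m \<ge> 4"
  shows "9 * real (m - 1) ^ 3 < real m ^ 4"
proof -
  obtain d where d: "m = d + 4" using assms le_Suc_ex by (metis add.commute)
  have "real m ^ 4 - 9 * real (m - 1) ^ 3 = 13 + 13 * real d + 15 * real d ^ 2 + 7 * real d ^ 3 + real d ^ 4"
    unfolding d by (simp add: of_nat_diff eval_nat_numeral algebra_simps)
  also have "\<dots> > 0" by (simp add: add_pos_nonneg)
  finally show ?thesis by simp
qed

text \<open>
  The sum over \<open>j\<close> of the pointwise bound of \<open>eventually_multinomial_minus_gauss_le\<close>, after
  inserting the bounds for the \<open>m\<close> third moments and for the total Gaussian mass.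
\<close>

definition discrepancy_bound :: "nat \<Rightarrow> real \<Rightarrow> nat \<Rightarrow> real" where
  "discrepancy_bound m K n = real m powr (real m / 2) / (2 * pi * real n) powr ((real m - 1) / 2) *
     (357/2000 * (real m)\<^sup>2 / (real n)\<^sup>2 * (real m * (gauss_norm (real m / (2 * real n)) (m - 2) * gauss_cubic_bound (real m / (2 * real n) * real m / real (m - 1))))
      + K / real n * gauss_norm (real m / (2 * real n)) (m - 1))"

text \<open>
  Multiplied by \<open>sqrt n\<close>, the bound becomes a polynomial \<open>F\<close> in \<open>h = 1 / sqrt n\<close>, and the main
  term a constant \<open>t\<close>. So it suffices to compare \<open>F 0\<close> with \<open>t\<close>. After squaring, all powers of
  \<open>\<pi>\<close> in \<open>(F 0)\<^sup>2\<close> cancel and \<open>(357/2000)\<^sup>2 256 (m - 1)\<^sup>3 / e\<^sup>3\<close> is left against \<open>2 m\<^sup>4 / (9\<pi>)\<close>.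
\<close>

lemma eventually_discrepancy_bound_le:
  assumes m: "m \<ge> 4"
  shows "eventually (\<lambda>n. discrepancy_bound m K n \<le> 2 * (real m)\<^sup>2 / (3 * sqrt (2 * pi * real n))) sequentially"
proof -
  define P where "P = sqrt (real m ^ m) / sqrt (2 * pi) ^ (m - 1)"
  define s where "s i = sqrt (2 * pi / real m * (real i / (real i + 1)))" for i
  define \<gamma> where "\<gamma> = (real m)\<^sup>2 / (2 * real (m - 1))"
  define w where "w = sqrt ((2 / (\<gamma> * exp 1)) ^ 3)"
  define v where "v = 2 * sqrt (pi / \<gamma>)"
  define F where "F h = P * (357/2000 * real m ^ 3 * ((\<Prod>i=1..m-2. s i + 2 * h) * (w * (v + 2 * h)))
      + K * h * (\<Prod>i=1..m-1. s i + 2 * h))" for h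
  define t where "t = 2 * (real m)\<^sup>2 / (3 * sqrt (2 * pi))"
  have scaled: "discrepancy_bound m K n = F (1 / sqrt (real n)) / sqrt (real n)" if n: "n \<ge> 1" for n
  proof -
    define r where "r = sqrt (real n)"
    have r: "r > 0" "real n = r\<^sup>2" using n by (auto simp: r_def)
    define k where "k = m - 2"
    have k: "m = Suc (Suc k)" using m by (simp add: k_def)
    define X where "X = (\<Prod>i=1..m-2. s i + 2 * (1 / r))"
    define Y where "Y = (\<Prod>i=1..m-1. s i + 2 * (1 / r))"
    have "real m / (2 * real n) * real m / real (m - 1) = \<gamma> / real n"
      using m by (simp add: \<gamma>_def power2_eq_square)
    then have c: "gauss_cubic_bound (real m / (2 * real n) * real m / real (m - 1)) = r ^ 4 * (w * (v + 2 * (1 / r)))"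
      using gauss_cubic_bound_scale[OF n, of \<gamma>] by (simp only: w_def v_def r_def)
    have g: "gauss_norm (real m / (2 * real n)) (m - 2) = r ^ (m - 2) * X"
      "gauss_norm (real m / (2 * real n)) (m - 1) = r ^ (m - 1) * Y"
      using gauss_norm_scale[OF n, of m] m by (simp_all add: X_def Y_def s_def r_def)
    have p: "real m powr (real m / 2) / (2 * pi * real n) powr ((real m - 1) / 2) = P / r ^ (m - 1)"
      using gauss_prefactor_eq[of m n] m n by (simp only: P_def r_def)
    have "discrepancy_bound m K n = P / r ^ (m - 1) * (357/2000 * (real m)\<^sup>2 / (r\<^sup>2)\<^sup>2 * (real m * (r ^ (m - 2) * X * (r ^ 4 * (w * (v + 2 * (1 / r))))))
      + K / r\<^sup>2 * (r ^ (m - 1) * Y))"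
      unfolding discrepancy_bound_def p c g unfolding r(2) ..
    also have "\<dots> = P * (357/2000 * real m ^ 3 * (X * (w * (v + 2 * (1 / r)))) + K * (1 / r) * Y) / r"
    proof -
      have a: "1 / r ^ (m - 1) * ((real m)\<^sup>2 / (r\<^sup>2)\<^sup>2 * (real m * (r ^ (m - 2) * r ^ 4))) = real m ^ 3 / r"
        unfolding k using r(1) by (simp add: field_simps eval_nat_numeral)
      have b: "1 / r ^ (m - 1) * (1 / r\<^sup>2 * r ^ (m - 1)) = 1 / r * (1 / r)"
        using r(1) by (simp add: power2_eq_square)
      have "P / r ^ (m - 1) * (357/2000 * (real m)\<^sup>2 / (r\<^sup>2)\<^sup>2 * (real m * (r ^ (m - 2) * X * (r ^ 4 * (w * (v + 2 * (1 / r))))))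
        + K / r\<^sup>2 * (r ^ (m - 1) * Y)) =
        P * (357/2000 * (X * (w * (v + 2 * (1 / r)))) * (1 / r ^ (m - 1) * ((real m)\<^sup>2 / (r\<^sup>2)\<^sup>2 * (real m * (r ^ (m - 2) * r ^ 4))))
          + K * Y * (1 / r ^ (m - 1) * (1 / r\<^sup>2 * r ^ (m - 1))))"
        by (simp only: divide_inverse distrib_left mult_1_left mult_ac)
      also have "\<dots> = P * (357/2000 * real m ^ 3 * (X * (w * (v + 2 * (1 / r)))) + K * (1 / r) * Y) / r"
        unfolding a b by (simp only: divide_inverse distrib_left distrib_right mult_1_left mult_ac)
      finally show ?thesis .
    qed
    finally show ?thesis by (simp only: F_def X_def Y_def r_def)
  qed
  have "((\<lambda>n. F (1 / sqrt (real n))) \<longlonglongrightarrow> F 0)"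
  proof -
    have "(\<lambda>n. 1 / sqrt (real n)) \<longlonglongrightarrow> 0" by real_asymp
    moreover have "isCont F 0" unfolding F_def[abs_def] by (intro continuous_intros)
    ultimately show ?thesis by (rule isCont_tendsto_compose[rotated])
  qed
  moreover have "F 0 < t"
  proof (rule power2_less_imp_less)
    define M where "M = real (m - 1)"
    have M: "M > 0" "real m > 0" using m by (auto simp: M_def)
    have prods: "(\<Prod>i=1..m-2. s i)\<^sup>2 = (2 * pi / real m) ^ (m - 2) / M"
    proof -
      have "(\<Prod>i=1..m-2. s i)\<^sup>2 = (\<Prod>i=1..m-2. 2 * pi / real m * (real i / (real i + 1)))"
        unfolding prod_power_distrib s_def by (intro prod.cong refl real_sqrt_pow2) simp
      also have "\<dots> = (2 * pi / real m) ^ (m - 2) * (1 / (real (m - 2) + 1))"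
        by (simp only: prod.distrib prod_constant card_atLeastAtMost prod_consecutive_ratio) simp
      also have "real (m - 2) + 1 = M" using m by (simp add: M_def of_nat_diff)
      finally show ?thesis by simp
    qed
    have \<gamma>: "\<gamma> > 0" using m by (simp add: \<gamma>_def)
    have F0: "F 0 = P * (357/2000 * real m ^ 3 * ((\<Prod>i=1..m-2. s i) * (w * v)))"
      by (simp add: F_def)
    have "(F 0)\<^sup>2 = P\<^sup>2 * ((357/2000)\<^sup>2 * real m ^ 6 * ((\<Prod>i=1..m-2. s i)\<^sup>2 * (w\<^sup>2 * v\<^sup>2)))"
      unfolding F0 power_mult_distrib power_mult[symmetric] by simp
    also have "P\<^sup>2 = real m ^ m / (2 * pi) ^ (m - 1)"
      by (simp add: P_def power_divide flip: real_sqrt_power)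
    also have "w\<^sup>2 = (4 * M / ((real m)\<^sup>2 * exp 1)) ^ 3"
      using \<gamma> by (simp add: w_def \<gamma>_def M_def)
    also have "v\<^sup>2 = 8 * pi * M / (real m)\<^sup>2"
      using \<gamma> by (simp add: v_def power_mult_distrib) (simp add: \<gamma>_def M_def)
    also have "real m ^ m / (2 * pi) ^ (m - 1) * ((357/2000)\<^sup>2 * real m ^ 6 * ((\<Prod>i=1..m-2. s i)\<^sup>2 * ((4 * M / ((real m)\<^sup>2 * exp 1)) ^ 3 * (8 * pi * M / (real m)\<^sup>2))))
       = (357/2000)\<^sup>2 * 256 * M ^ 3 / exp 1 ^ 3"
    proof -
      define k where "k = m - 2"
      have k: "m = Suc (Suc k)" using m by (simp add: k_def)
      define a where "a = real m"
      have a: "a > 0" using M by (simp add: a_def)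
      have e: "real m ^ m = a\<^sup>2 * a ^ k" "(2 * pi) ^ (m - 1) = 2 * pi * (2 * pi) ^ k" "m - 2 = k"
        unfolding a_def by (simp_all add: k power2_eq_square)
      \<comment> \<open>Naming the powers with exponent \<open>k\<close> turns the cancellation into a rational identity.\<close>
      have "c\<^sup>2 * ak / (2 * pi * pk) * (q * c ^ 6 * (pk / ak / M * ((4 * M / (c\<^sup>2 * E)) ^ 3 * (8 * pi * M / c\<^sup>2)))) = q * 256 * M ^ 3 / E ^ 3"
        if "c > 0" "ak > 0" "pk > 0" "E > 0" for c ak pk q E :: real
        using that M(1) by (simp add: field_simps eval_nat_numeral)
      note cancel = this
      show ?thesis
        unfolding prods unfolding e unfolding a_def[symmetric] power_divide[of "2 * pi"]
        by (rule cancel) (use a in auto)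
    qed
    also have "\<dots> < t\<^sup>2"
    proof -
      have "(357/2000)\<^sup>2 * 256 * M ^ 3 / exp 1 ^ 3 \<le> (357/2000)\<^sup>2 * 256 * M ^ 3 / 18"
        using exp_1_cubed_ge M by (intro divide_left_mono) auto
      also have "\<dots> < (357/2000)\<^sup>2 * 256 * (real m ^ 4 / 9) / 18"
        using nine_cubes_less_fourth_power[OF m] by (simp add: M_def)
      also have "\<dots> \<le> 2 / 9 / 4 * real m ^ 4"
        by (simp add: power2_eq_square)
      also have "\<dots> \<le> 2 / 9 / pi * real m ^ 4"
        using pi_less_4 by (intro mult_right_mono divide_left_mono) auto
      also have "\<dots> = t\<^sup>2"
        by (simp add: t_def power_divide power_mult_distrib field_simps flip: power_mult)
      finally show ?thesis .
    qed
    finally show "(F 0)\<^sup>2 < t\<^sup>2" .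
    show "0 \<le> t" by (simp add: t_def)
  qed
  ultimately have "eventually (\<lambda>n. F (1 / sqrt (real n)) < t) sequentially"
    by (rule order_tendstoD)
  then show ?thesis
    using eventually_ge_at_top[of 1]
  proof eventually_elim
    case (elim n)
    then have "F (1 / sqrt (real n)) / sqrt (real n) \<le> t / sqrt (real n)"
      by (intro divide_right_mono) auto
    also have "t / sqrt (real n) = 2 * (real m)\<^sup>2 / (3 * sqrt (2 * pi * real n))"
      by (simp add: t_def real_sqrt_mult)
    finally show ?case using scaled elim by simp
  qed
qed

section \<open>The discrepancy\<close>

lemma sum_zero_sum_extend:
  fixes j :: "nat \<Rightarrow> int" and f :: "real \<Rightarrow> real"
  assumes "m \<ge> 1"
  shows "(\<Sum>i=1..m. f (of_int (zero_sum_extend m j i))) =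
    (\<Sum>i=1..m - 1. f (of_int (j i))) + f (- (\<Sum>i=1..m - 1. of_int (j i)))"
proof -
  have "{1..m} = insert m {1..m - 1}" "m \<notin> {1..m - 1}" using assms by auto
  moreover have "(\<Sum>i=1..m - 1. f (of_int (zero_sum_extend m j i))) = (\<Sum>i=1..m - 1. f (of_int (j i)))"
    using assms by (intro sum.cong) (auto simp: zero_sum_extend_def)
  ultimately show ?thesis by (simp add: zero_sum_extend_def)
qed

lemma D_le_discrepancy_bound:
  assumes m: "m \<ge> 2" and n: "n \<ge> 1" and K: "K \<ge> 0"
    and approx: "\<And>j. j \<in> {1..m - 1} \<rightarrow>\<^sub>E {- \<lfloor>b * sqrt (real n)\<rfloor>..\<lfloor>b * sqrt (real n)\<rfloor>} \<Longrightarrow>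
      (let y = (\<lambda>i. real_of_int (zero_sum_extend m j i)) in
        \<bar>1 / real m ^ n * multinomial m n (\<lambda>i. real n / real m + y i) - gauss_weight m n y\<bar> \<le>
        gauss_weight m n y * (357/2000 * (real m)\<^sup>2 / (real n)\<^sup>2 * (\<Sum>i=1..m. \<bar>y i\<bar> ^ 3) + K / real n))"
  shows "D m b n \<le> discrepancy_bound m K n"
proof -
  define I where "I = {1..m - 1}"
  define T where "T = {- \<lfloor>b * sqrt (real n)\<rfloor>..\<lfloor>b * sqrt (real n)\<rfloor>}"
  define \<alpha> where "\<alpha> = real m / (2 * real n)"
  define P where "P = real m powr (real m / 2) / (2 * pi * real n) powr ((real m - 1) / 2)"
  define A where "A = 357/2000 * (real m)\<^sup>2 / (real n)\<^sup>2"
  define W where "W j = exp (- \<alpha> * ((\<Sum>i\<in>I. (real_of_int (j i))\<^sup>2) + (\<Sum>i\<in>I. of_int (j i))\<^sup>2))" for j :: "nat \<Rightarrow> int"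
  define B where "B = gauss_norm \<alpha> (m - 2) * gauss_cubic_bound (\<alpha> * real m / real (m - 1))"
  have I: "finite I" "card I = m - 1" "card I - 1 = m - 2" "real (card I) + 1 = real m"
    using m by (auto simp: I_def of_nat_diff)
  have T: "finite T" by (simp add: T_def)
  have \<alpha>: "\<alpha> > 0" using m n by (simp add: \<alpha>_def)
  have P: "P \<ge> 0" by (simp add: P_def)
  have A: "A \<ge> 0" by (simp add: A_def)
  have B: "(\<Sum>j\<in>I \<rightarrow>\<^sub>E T. \<bar>of_int (j l)\<bar> ^ 3 * W j) \<le> B"
    "(\<Sum>j\<in>I \<rightarrow>\<^sub>E T. \<bar>\<Sum>i\<in>I. of_int (j i)\<bar> ^ 3 * W j) \<le> B" if "l \<in> I" for l
    using gauss_third_moment_le[OF \<alpha> T I(1) that] 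
    unfolding W_def B_def I(3,4) unfolding I(2) by simp_all
  have total: "(\<Sum>j\<in>I \<rightarrow>\<^sub>E T. W j) \<le> gauss_norm \<alpha> (m - 1)"
    using gauss_fixed_sum_le[OF \<alpha> T I(1), of 0] unfolding W_def I(2) by simp
  have G: "gauss_weight m n (\<lambda>i. real_of_int (zero_sum_extend m j i)) = P * W j" for j
  proof -
    have "- real m / 2 * (\<Sum>i=1..m. (real_of_int (zero_sum_extend m j i))\<^sup>2 / real n)
      = - \<alpha> * (\<Sum>i=1..m. (real_of_int (zero_sum_extend m j i))\<^sup>2)"
      by (simp add: \<alpha>_def sum_divide_distrib[symmetric])
    also have "\<dots> = - \<alpha> * ((\<Sum>i\<in>I. (real_of_int (j i))\<^sup>2) + (\<Sum>i\<in>I. of_int (j i))\<^sup>2)"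
      using m by (subst sum_zero_sum_extend[of m "\<lambda>x. x\<^sup>2"]) (auto simp: I_def)
    finally show ?thesis by (simp only: gauss_weight_def P_def W_def)
  qed
  have "D m b n = (\<Sum>j\<in>I \<rightarrow>\<^sub>E T. \<bar>1 / real m ^ n * multinomial m n (\<lambda>i. real n / real m + of_int (zero_sum_extend m j i))
      - gauss_weight m n (\<lambda>i. of_int (zero_sum_extend m j i))\<bar>)"
    by (simp only: D_def I_def T_def gauss_weight_def)
  also have "\<dots> \<le> (\<Sum>j\<in>I \<rightarrow>\<^sub>E T. P * W j * (A * ((\<Sum>i\<in>I. \<bar>of_int (j i)\<bar> ^ 3) + \<bar>\<Sum>i\<in>I. of_int (j i)\<bar> ^ 3) + K / real n))"
  proof (rule sum_mono)
    fix j assume "j \<in> I \<rightarrow>\<^sub>E T"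
    then have "\<bar>1 / real m ^ n * multinomial m n (\<lambda>i. real n / real m + of_int (zero_sum_extend m j i))
      - gauss_weight m n (\<lambda>i. of_int (zero_sum_extend m j i))\<bar>
      \<le> P * W j * (A * (\<Sum>i=1..m. \<bar>of_int (zero_sum_extend m j i)\<bar> ^ 3) + K / real n)"
      using approx[of j] unfolding Let_def G I_def T_def A_def by blast
    also have "(\<Sum>i=1..m. \<bar>of_int (zero_sum_extend m j i)\<bar> ^ 3) =
        (\<Sum>i\<in>I. \<bar>of_int (j i)\<bar> ^ 3) + \<bar>\<Sum>i\<in>I. real_of_int (j i)\<bar> ^ 3"
      using m by (subst sum_zero_sum_extend[of m "\<lambda>x. \<bar>x\<bar> ^ 3"]) (auto simp: I_def)
    finally show "\<bar>1 / real m ^ n * multinomial m n (\<lambda>i. real n / real m + of_int (zero_sum_extend m j i))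
      - gauss_weight m n (\<lambda>i. of_int (zero_sum_extend m j i))\<bar>
      \<le> P * W j * (A * ((\<Sum>i\<in>I. \<bar>of_int (j i)\<bar> ^ 3) + \<bar>\<Sum>i\<in>I. of_int (j i)\<bar> ^ 3) + K / real n)" .
  qed
  also have "\<dots> = P * (A * ((\<Sum>l\<in>I. \<Sum>j\<in>I \<rightarrow>\<^sub>E T. \<bar>of_int (j l)\<bar> ^ 3 * W j) +
      (\<Sum>j\<in>I \<rightarrow>\<^sub>E T. \<bar>\<Sum>i\<in>I. of_int (j i)\<bar> ^ 3 * W j)) + K / real n * (\<Sum>j\<in>I \<rightarrow>\<^sub>E T. W j))"
    unfolding sum.swap[of _ "I \<rightarrow>\<^sub>E T" I]
    by (simp only: sum_distrib_left sum_distrib_right sum.distrib[symmetric] distrib_left distrib_right mult_ac)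
  also have "\<dots> \<le> P * (A * ((\<Sum>l\<in>I. B) + B) + K / real n * gauss_norm \<alpha> (m - 1))"
  proof (intro mult_left_mono add_mono sum_mono B total P A)
    show "1 \<in> I" using m by (simp add: I_def)
  qed (use K in auto)
  also have "(\<Sum>l\<in>I. B) + B = real m * B"
    using I(4) by (simp add: algebra_simps flip: I(4))
  finally show ?thesis
    by (simp only: discrepancy_bound_def P_def A_def B_def \<alpha>_def)
qed

lemma eventually_D_le:
  assumes m: "m \<ge> 4" and b: "b > 0"
  shows "eventually (\<lambda>n. D m b n \<le> 2 * (real m)\<^sup>2 / (3 * sqrt (2 * pi * real n))) sequentially"
proof -
  \<comment> \<open>The last coordinate is a sum of \<open>m - 1\<close> coordinates of size at most \<open>b sqrt n\<close>.\<close>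
  define C where "C = real m * b"
  define K where "K = 51/50 * (real m ^ 3 * C\<^sup>2 + (real m)\<^sup>2)"
  have C: "C \<ge> 0" using b by (simp add: C_def)
  have K: "K \<ge> 0" by (simp add: K_def)
  have "m \<ge> 1" using m by simp
  from eventually_multinomial_minus_gauss_le[OF this C] eventually_discrepancy_bound_le[OF m, of K]
    eventually_ge_at_top[of 1]
  show ?thesis
  proof eventually_elim
    case (elim n)
    have "D m b n \<le> discrepancy_bound m K n"
    proof (rule D_le_discrepancy_bound)
      fix j assume j: "j \<in> {1..m - 1} \<rightarrow>\<^sub>E {- \<lfloor>b * sqrt (real n)\<rfloor>..\<lfloor>b * sqrt (real n)\<rfloor>}"
      define y where "y i = real_of_int (zero_sum_extend m j i)" for i
      have zero: "(\<Sum>i=1..m. y i) = 0"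
        using sum_zero_sum_extend[of m "\<lambda>x. x" j] m by (simp add: y_def)
      have ji: "\<bar>real_of_int (j i)\<bar> \<le> b * sqrt (real n)" if "i \<in> {1..m - 1}" for i
      proof -
        have "\<bar>j i\<bar> \<le> \<lfloor>b * sqrt (real n)\<rfloor>" using PiE_mem[OF j that] by auto
        then show ?thesis by linarith
      qed
      have "\<bar>y i\<bar> \<le> C * sqrt (real n)" if "i \<in> {1..m}" for i
      proof (cases "i = m")
        case False
        then have "i \<in> {1..m - 1}" using that by auto
        from ji[OF this] have "\<bar>y i\<bar> \<le> 1 * (b * sqrt (real n))"
          using False by (simp add: y_def zero_sum_extend_def)
        also have "\<dots> \<le> real m * (b * sqrt (real n))"
          using m b by (intro mult_right_mono) auto
        finally show ?thesis by (simp add: C_def mult.assoc)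
      next
        case True
        then have "\<bar>y i\<bar> = \<bar>\<Sum>i=1..m - 1. real_of_int (j i)\<bar>"
          by (simp add: y_def zero_sum_extend_def)
        also have "\<dots> \<le> (\<Sum>i=1..m - 1. b * sqrt (real n))"
          using ji by (intro order_trans[OF sum_abs] sum_mono)
        also have "\<dots> = real (m - 1) * (b * sqrt (real n))" by simp
        also have "\<dots> \<le> real m * (b * sqrt (real n))"
          using b by (intro mult_right_mono) auto
        finally show ?thesis by (simp add: C_def mult.assoc)
      qed
      with elim(1) zero
      have "\<bar>1 / real m ^ n * multinomial m n (\<lambda>i. real n / real m + y i) - gauss_weight m n y\<bar> \<le>
        gauss_weight m n y * (357/2000 * (real m)\<^sup>2 / (real n)\<^sup>2 * (\<Sum>i=1..m. \<bar>y i\<bar> ^ 3) + K / real n)"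
        unfolding K_def by blast
      then show "let y = (\<lambda>i. real_of_int (zero_sum_extend m j i)) in
        \<bar>1 / real m ^ n * multinomial m n (\<lambda>i. real n / real m + y i) - gauss_weight m n y\<bar> \<le>
        gauss_weight m n y * (357/2000 * (real m)\<^sup>2 / (real n)\<^sup>2 * (\<Sum>i=1..m. \<bar>y i\<bar> ^ 3) + K / real n)"
        unfolding Let_def y_def .
    qed (use m elim K in auto)
    then show ?case using elim(2) by linarith
  qed
qed

theorem theorem1:
  fixes \<Omega> :: "'a measure" and Z :: "'a \<Rightarrow> real"
    and f :: "real \<Rightarrow> real" and \<epsilon> b\<^sub>0 b\<^sub>1 b :: real
    and M m :: nat and v :: "nat \<Rightarrow> real"
  assumes "\<epsilon> > 0"
    and "continuous_on UNIV f" and "bounded (range f)"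
    and "prob_space \<Omega>" and "Z \<in> borel_measurable \<Omega>"
    and "integrable \<Omega> Z" and "integrable \<Omega> (\<lambda>\<omega>. (Z \<omega>)\<^sup>2)"
    and "prob_space.expectation \<Omega> Z = 0" and "prob_space.variance \<Omega> Z = 1"
    and "M \<ge> 1" and "haar_sigma (quantile \<Omega> Z) M > 0"
    and "m = 2 ^ (M + 1)"
    and "interval_values (haar_approx (quantile \<Omega> Z) M) m v"
    and "\<forall>b'\<ge>b\<^sub>0. \<forall>n\<ge>1.
          \<bar>(\<Sum>k\<in>all_tuples m n. q_term f m v n k) - (\<Sum>k\<in>central_tuples m b' n. q_term f m v n k)\<bar>
            < \<epsilon> * (SUP x. \<bar>f x\<bar>)"
    and "b\<^sub>1 > 0" and "\<forall>b'\<ge>b\<^sub>1. gauss_tail m b' < \<epsilon>"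
    and "b \<ge> max b\<^sub>0 b\<^sub>1"
  shows "\<exists>R. R \<in> O(\<lambda>n. 1 / real n) \<and>
           (\<forall>n\<ge>1. D m b n \<le> 2 * (real m)\<^sup>2 / (3 * sqrt (2 * pi * real n)) + R n)"
proof -
  have "(2::nat) ^ 2 \<le> 2 ^ (M + 1)" using \<open>M \<ge> 1\<close> by (intro power_increasing) auto
  then have m: "m \<ge> 4" using \<open>m = 2 ^ (M + 1)\<close> by simp
  have b: "b > 0" using \<open>b\<^sub>1 > 0\<close> \<open>b \<ge> max b\<^sub>0 b\<^sub>1\<close> by simp
  define R where "R n = max 0 (D m b n - 2 * (real m)\<^sup>2 / (3 * sqrt (2 * pi * real n)))" for n
  have "eventually (\<lambda>n. R n = 0) sequentially"
    using eventually_D_le[OF m b] by eventually_elim (simp add: R_def)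
  then have "R \<in> O(\<lambda>n. 1 / real n)"
    by (intro bigoI[of _ 0]) (auto elim: eventually_mono)
  moreover have "D m b n \<le> 2 * (real m)\<^sup>2 / (3 * sqrt (2 * pi * real n)) + R n" for n
    by (simp add: R_def)
  ultimately show ?thesis by blast
qed

end
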